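(* For a positive integer $k$ let $\sigma(k)=\sum_{d\mid k} d$ denote the sum of the positive divisors of $k$, and for a positive integer $n$ define \[ F(n)=\sum_{k=1}^{n} k\,\sigma(k)\,(k^2-3n+2)(2k^2-n)\binom{2n}{n-k}. \] Then for every integer $n\geq 10000$, \[ \left|\frac{F(n)}{\binom{2n}{n}}-\left(-\frac{n^2}{8}+\frac{n}{24}\right)\right|\leq \frac{38755553}{5000}\, n^{3/4}. \]
   Context: In the paper this is written as $F(n)=\binom{2n}{n}\big(-\frac{n^2}{8}+\frac{n}{24}+B_{n\geq N}(\frac{38755553}{5000}n^{3/4})\big)$ with $N=10000$, where a $B$-term $B_{n\geq N}(f(n))$ denotes an unspecified quantity whose absolute value is at most $f(n)$ for all $n\geq N$. *)

theory Defs
  imports "HOL-Analysis.Analysis"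
begin

definition sigma :: "nat \<Rightarrow> nat" where
  "sigma k = (\<Sum>d | d dvd k. d)"

definition F :: "nat \<Rightarrow> int" where
  "F n = (\<Sum>k=1..n. int k * int (sigma k) * ((int k)\<^sup>2 - 3 * int n + 2)
            * (2 * (int k)\<^sup>2 - int n) * int ((2 * n) choose (n - k)))"

end

theory Submission
  imports Defs
begin

text \<open>
  Put \<open>g k = k (k\<^sup>2 - 3n + 2) (2k\<^sup>2 - n) binomial(2n, n + k)\<close> and \<open>G s = \<Sum> g k e\<^sup>k\<^sup>s\<close>. Then \<open>F n\<close> is the mean of
  \<open>A s * G s\<close> over a vertical segment \<open>s = \<epsilon> + i t\<close>, \<open>\<bar>t\<bar> \<le> \<pi>\<close>, where \<open>A s = \<Sum> \<sigma>(k) e\<^sup>-\<^sup>k\<^sup>s\<close> is the quasimodular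
  Eisenstein series of weight 2; we take \<open>\<epsilon> = 2 / sqrt n\<close>. Its transformation law gives
  \<open>A s = \<pi>\<^sup>2/(6s\<^sup>2) - 1/(2s) + 1/24\<close> up to a term which is negligible on this line.
  Since \<open>\<Sum> k g k = 0\<close> and \<open>\<Sum> g k = 0\<close> (sums over \<open>k \<ge> 1\<close>), one may subtract
  \<open>\<pi>\<^sup>2/6 \<Sum> k e\<^sup>-\<^sup>k\<^sup>s - 1/2 \<Sum> e\<^sup>-\<^sup>k\<^sup>s\<close>, which removes the poles at \<open>s = 0\<close>. What is left is approximated up to
  \<open>O(s\<^sup>5)\<close> by a trigonometric polynomial; its contribution is an explicit combination of \<open>g 1\<close> and \<open>g 2\<close>
  and equals the main term up to a bounded error. On the line, \<open>G\<close> is concentrated at \<open>\<bar>s\<bar> \<approx> 1 / sqrt n\<close>,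
  so the remainder contributes \<open>O(sqrt n)\<close>.
\<close>

section \<open>Partial fraction expansions\<close>

text \<open>There is no split into major and minor arcs. The transformed series in the law for
  \<open>A\<close> is exponentially small near the real axis but large near
  \<open>t = \<plusminus>\<pi>\<close>. It is therefore replaced by a bound of order n^5 |s|^18
  valid on the whole segment, and the factor exp(- n |sinh(s/2)|^2) hidden in \<open>G\<close>
  absorbs every power of |s|. All sizes are measured by w = |sinh(s/2)|, which is comparable with
  |s|. Up to this factor \<open>G\<close> is of size 4^n n^4 w^3 near 0. An error of order s^5 in
  the other factor thus leaves 4^n n^4 w^8, that is O(4^n), or O(sqrt n) relative to the central
  binomial coefficient. This is why agreement through s^4 suffices, even though the integral is
  bounded crudely by the supremum of its integrand. The abscissa must have order 1/sqrt n: a larger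
  one makes \<open>G\<close> grow through the power of cosh, a smaller one spoils the bound on the
  transformed series, which contains (Re s)^(-10).\<close>

text \<open>Logarithmic derivative of the reflection formula: the entire function
  \<open>rGamma\<close> makes \<open>f\<close> equal to sin(pi z)/pi, and dividing its derivative by
  \<open>f\<close> gives the cotangent.\<close>

lemma Digamma_reflection_complex:
  fixes z :: complex
  assumes "z \<notin> \<int>"
  shows "Digamma (1 - z) - Digamma z = of_real pi * cot (of_real pi * z)"
proof -
  have z1: "z \<notin> \<int>\<^sub>\<le>\<^sub>0" using assms nonpos_Ints_Int by blast
  have "1 - z \<notin> \<int>" using assms by (metis Ints_1 Ints_diff add_diff_cancel_left' diff_diff_eq2 diff_add_cancel)
  hence z2: "1 - z \<notin> \<int>\<^sub>\<le>\<^sub>0" using nonpos_Ints_Int by blast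
  have s: "sin (of_real pi * z) \<noteq> 0"
    using assms by (subst sin_eq_0) (auto simp: Ints_def mult.commute[of pi])
  define f where "f = (\<lambda>z::complex. rGamma z * rGamma (1 - z))"
  have f_eq: "f = (\<lambda>z. sin (of_real pi * z) / of_real pi)"
    unfolding f_def using rGamma_reflection_complex by auto
  have "(f has_field_derivative (f z * (Digamma (1 - z) - Digamma z))) (at z)"
    unfolding f_def using z1 z2
    by (auto intro!: derivative_eq_intros simp: algebra_simps)
  moreover have "(f has_field_derivative cos (of_real pi * z)) (at z)"
    unfolding f_eq by (auto intro!: derivative_eq_intros)
  ultimately have "f z * (Digamma (1 - z) - Digamma z) = cos (of_real pi * z)"
    by (rule DERIV_unique)
  thus ?thesis using s by (simp add: f_eq cot_def field_simps)
qed

lemma Polygamma_1_reflection_complex: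
  fixes z :: complex
  assumes "z \<notin> \<int>"
  shows "Polygamma 1 (1 - z) + Polygamma 1 z = (of_real pi / sin (of_real pi * z))\<^sup>2"
proof -
  have z1: "z \<notin> \<int>\<^sub>\<le>\<^sub>0" using assms nonpos_Ints_Int by blast
  have "1 - z \<notin> \<int>" using assms by (metis Ints_1 Ints_diff add_diff_cancel_left' diff_diff_eq2 diff_add_cancel)
  hence z2: "1 - z \<notin> \<int>\<^sub>\<le>\<^sub>0" using nonpos_Ints_Int by blast
  have s: "sin (of_real pi * z) \<noteq> 0"
    using assms by (subst sin_eq_0) (auto simp: Ints_def mult.commute[of pi])
  have "((\<lambda>z. Digamma (1 - z) - Digamma z) has_field_derivative - Polygamma 1 (1 - z) - Polygamma 1 z) (at z)"
    using z1 z2 by (auto intro!: derivative_eq_intros)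
  moreover have "((\<lambda>z. Digamma (1 - z) - Digamma z) has_field_derivative
      - (of_real pi / sin (of_real pi * z))\<^sup>2) (at z)"
  proof (rule has_field_derivative_transform_within_open)
    have "- sin w * of_real pi * sin w - cos w * (cos w * of_real pi) = - of_real pi" for w :: complex
      using sin_cos_squared_add[of w] by (simp add: power2_eq_square algebra_simps flip: distrib_left)
    hence *: "of_real pi * ((- sin w * of_real pi * sin w - cos w * (cos w * of_real pi)) / (sin w * sin w))
       = - (of_real pi / sin w)\<^sup>2" for w :: complex
      by (simp add: power2_eq_square)
    show "((\<lambda>z. of_real pi * (cos (of_real pi * z) / sin (of_real pi * z))) has_field_derivative
      - (of_real pi / sin (of_real pi * z))\<^sup>2) (at z)"
      unfolding *[symmetric] using s by (auto intro!: derivative_eq_intros simp: algebra_simps)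
    show "open (- (\<int> :: complex set))" using closed_Ints by blast
  qed (use assms in \<open>auto simp: Digamma_reflection_complex cot_def\<close>)
  ultimately have "- Polygamma 1 (1 - z) - Polygamma 1 z = - (of_real pi / sin (of_real pi * z))\<^sup>2"
    by (rule DERIV_unique)
  thus ?thesis by (simp add: algebra_simps)
qed

text \<open>The bilateral series splits into the trigamma series at \<open>z\<close> for the
  nonnegative shifts and at \<open>1 - z\<close> for the negative ones; the unpaired term 1/z^2 goes
  to the right-hand side.\<close>

lemma sums_inverse_sin_squared:
  fixes z :: complex
  assumes "z \<notin> \<int>"
  shows "(\<lambda>m. 1 / (z + of_nat (Suc m))\<^sup>2 + 1 / (z - of_nat (Suc m))\<^sup>2) sums
           ((of_real pi / sin (of_real pi * z))\<^sup>2 - 1 / z\<^sup>2)"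
proof -
  have z0: "z \<noteq> 0" using assms by auto
  have "1 - z \<notin> \<int>" using assms by (metis Ints_1 Ints_diff add_diff_cancel_left' diff_diff_eq2 diff_add_cancel)
  hence z2: "1 - z \<noteq> 0" by auto
  have "(\<lambda>k. inverse ((z + of_nat k)^2)) sums Polygamma 1 z"
    using Polygamma_LIMSEQ[of z 1] z0 by (simp add: numeral_2_eq_2)
  hence "(\<lambda>k. inverse ((z + of_nat (Suc k))^2)) sums (Polygamma 1 z - inverse (z^2))"
    by (subst sums_Suc_iff) simp
  moreover have "(\<lambda>k. inverse ((1 - z + of_nat k)^2)) sums Polygamma 1 (1 - z)"
    using Polygamma_LIMSEQ[of "1 - z" 1] z2 by (simp add: numeral_2_eq_2)
  moreover have "(1 - z + of_nat k)^2 = (z - of_nat (Suc k))^2" for k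
    by (simp add: power2_eq_square algebra_simps)
  ultimately have "(\<lambda>k. inverse ((z + of_nat (Suc k))^2) + inverse ((z - of_nat (Suc k))^2))
      sums (Polygamma 1 z - inverse (z^2) + Polygamma 1 (1 - z))"
    by (intro sums_add) auto
  thus ?thesis using Polygamma_1_reflection_complex[OF assms]
    by (simp add: field_simps)
qed

text \<open>Difference of the digamma series at \<open>z + 1\<close> and \<open>1 - z\<close>, in
  which the harmonic terms cancel. It serves to sum the boundary terms in the transformation
  law.\<close>

lemma sums_cot:
  fixes z :: complex
  assumes "z \<notin> \<int>"
  shows "(\<lambda>m. 2 * z / ((of_nat (Suc m))\<^sup>2 - z\<^sup>2)) sums (1 / z - of_real pi * cot (of_real pi * z))"
proof -
  have z0: "z \<noteq> 0" using assms by auto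
  have "1 - z \<notin> \<int>" using assms by (metis Ints_1 Ints_diff add_diff_cancel_left' diff_diff_eq2 diff_add_cancel)
  hence z2: "1 - z \<noteq> 0" by auto
  have "1 + z \<notin> \<int>" using assms by (metis Ints_1 Ints_diff add_diff_cancel_left')
  hence z3: "z + 1 \<noteq> 0" by (metis Ints_0 add.commute)
  have D: "(\<lambda>k. inverse (of_nat (Suc k)) - inverse (w + of_nat k)) sums (Digamma w + euler_mascheroni)"
    if "w \<noteq> 0" for w :: complex
    using summable_Digamma[OF that] by (simp add: Digamma_def sums_iff)
  have "(\<lambda>k. (inverse (of_nat (Suc k)) - inverse (z + 1 + of_nat k)) - (inverse (of_nat (Suc k)) - inverse (1 - z + of_nat k)))
     sums ((Digamma (z + 1) + euler_mascheroni) - (Digamma (1 - z) + euler_mascheroni))"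
    by (intro sums_diff D z2 z3)
  also have "(\<lambda>k. (inverse (of_nat (Suc k)) - inverse (z + 1 + of_nat k)) - (inverse (of_nat (Suc k)) - inverse (1 - z + of_nat k)))
    = (\<lambda>m. 2 * z / ((of_nat (Suc m))\<^sup>2 - z\<^sup>2))"
  proof
    fix m
    have "of_nat (Suc m) \<in> (\<int>::complex set)" "- of_nat (Suc m) \<in> (\<int>::complex set)" by auto
    hence "z \<noteq> of_nat (Suc m)" "z \<noteq> - of_nat (Suc m)" using assms by metis+
    hence a: "of_nat (Suc m) - z \<noteq> 0" "of_nat (Suc m) + z \<noteq> 0"
      by (auto simp del: of_nat_Suc simp: add_eq_0_iff)
    have b: "(of_nat (Suc m))\<^sup>2 - z\<^sup>2 = (of_nat (Suc m) - z) * (of_nat (Suc m) + z)"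
      by (simp add: power2_eq_square algebra_simps)
    have c: "z + 1 + of_nat m = of_nat (Suc m) + z" "1 - z + of_nat m = of_nat (Suc m) - z" by auto
    have d: "(x - inverse q) - (x - inverse p) = (q - p) / (p * q)" if "p \<noteq> 0" "q \<noteq> 0" for p q x :: complex
      using that by (simp add: field_simps)
    show "(inverse (of_nat (Suc m)) - inverse (z + 1 + of_nat m)) - (inverse (of_nat (Suc m)) - inverse (1 - z + of_nat m)) = 2 * z / ((of_nat (Suc m))\<^sup>2 - z\<^sup>2)"
      unfolding b c d[OF a] by simp
  qed
  also have "(Digamma (z + 1) + euler_mascheroni) - (Digamma (1 - z) + euler_mascheroni)
     = 1 / z - of_real pi * cot (of_real pi * z)"
    using Digamma_plus1[OF z0] Digamma_reflection_complex[OF assms] by (simp add: algebra_simps)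
  finally show ?thesis .
qed

section \<open>The transformation law of the weight 2 Eisenstein series\<close>

text \<open>Fubini with a product majorant. Since \<open>sums\<close> fixes an order of summation,
  the proof passes through the unordered \<open>has_sum\<close> on pairs.\<close>

lemma sums_swap_dominated:
  fixes f :: "nat \<Rightarrow> nat \<Rightarrow> 'a :: banach"
  assumes dom: "\<And>m k. norm (f m k) \<le> a m * b k"
    and a: "summable a" "\<And>m. a m \<ge> 0" and b: "summable b" "\<And>k. b k \<ge> 0"
    and row: "\<And>m. f m sums r m" and col: "\<And>k. (\<lambda>m. f m k) sums c k"
  shows "\<exists>S. r sums S \<and> c sums S"
proof -
  have b': "(b has_sum suminf b) UNIV" "(a has_sum suminf a) UNIV"
    using a b by (auto intro!: norm_summable_imp_has_sum)
  have "(\<lambda>(m, k). a m * b k) summable_on (UNIV \<times> UNIV)"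
  proof (rule summable_on_SigmaI)
    show "((\<lambda>y. case (m, y) of (m, k) \<Rightarrow> a m * b k) has_sum (a m * suminf b)) UNIV" for m
      using has_sum_cmult_right[OF b'(1), of "a m"] by simp
    show "(\<lambda>m. a m * suminf b) summable_on UNIV"
      using has_sum_cmult_left[OF b'(2), of "suminf b"] by (auto simp: summable_on_def)
  qed (use a b in auto)
  hence "(\<lambda>(m, k). f m k) abs_summable_on (UNIV \<times> UNIV)"
    by (rule Infinite_Sum.abs_summable_on_comparison_test') (use dom in auto)
  hence "(\<lambda>(m, k). f m k) summable_on (UNIV \<times> UNIV)"
    by (rule abs_summable_summable)
  then obtain S where S: "((\<lambda>(m, k). f m k) has_sum S) (UNIV \<times> UNIV)"
    by (auto simp: summable_on_def)
  have row': "(f m has_sum r m) UNIV" for m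
  proof (rule norm_summable_imp_has_sum[OF _ row])
    show "summable (\<lambda>n. norm (f m n))"
      by (rule summable_comparison_test'[OF summable_mult[OF b(1), of "a m"], of 0]) (use dom in auto)
  qed
  have col': "((\<lambda>m. f m k) has_sum c k) UNIV" for k
  proof (rule norm_summable_imp_has_sum[OF _ col])
    show "summable (\<lambda>m. norm (f m k))"
      by (rule summable_comparison_test'[OF summable_mult2[OF a(1), of "b k"], of 0]) (use dom in auto)
  qed
  have "(r has_sum S) UNIV"
    by (rule has_sum_SigmaD[OF S]) (use row' in auto)
  moreover have "((\<lambda>(k, m). f m k) has_sum S) (UNIV \<times> UNIV)"
    using S by (subst has_sum_swap) (simp add: case_prod_unfold)
  hence "(c has_sum S) UNIV"
    by (rule has_sum_SigmaD) (use col' in auto)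
  ultimately show ?thesis using has_sum_imp_sums by blast
qed

text \<open>Closed form of the sum of d exp(- d w) over d \<ge> 1, written with sinh so that the
  double poles at the multiples of 2 pi i are visible.\<close>

definition csch_half_sq :: "complex \<Rightarrow> complex" where
  "csch_half_sq w = 1 / (2 * sinh (w / 2))\<^sup>2"

lemma sin_ii_times: "sin (\<i> * x) = \<i> * sinh x" for x :: complex
  by (simp add: sinh_conv_sin)

lemma sums_csch_half_sq:
  assumes "Re w > 0"
  shows "(\<lambda>k. 1 / (w + 2 * of_real pi * \<i> * of_nat (Suc k))\<^sup>2 + 1 / (w - 2 * of_real pi * \<i> * of_nat (Suc k))\<^sup>2)
           sums (csch_half_sq w - 1 / w\<^sup>2)"
proof -
  define p where "p = 2 * of_real pi * \<i>"
  have p0: "p \<noteq> 0" by (simp add: p_def)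
  define z where "z = w / p"
  have w: "w = p * z" using p0 by (simp add: z_def)
  have "z \<notin> \<int>"
  proof
    assume "z \<in> \<int>"
    then obtain j where "z = of_int j" by (auto elim: Ints_cases)
    with w assms show False by (simp add: p_def)
  qed
  from sums_mult[OF sums_inverse_sin_squared[OF this], of "1 / p\<^sup>2"]
  have "(\<lambda>m. 1 / p\<^sup>2 * (1 / (z + of_nat (Suc m))\<^sup>2 + 1 / (z - of_nat (Suc m))\<^sup>2)) sums
           (1 / p\<^sup>2 * ((of_real pi / sin (of_real pi * z))\<^sup>2 - 1 / z\<^sup>2))" .
  also have "(\<lambda>m. 1 / p\<^sup>2 * (1 / (z + of_nat (Suc m))\<^sup>2 + 1 / (z - of_nat (Suc m))\<^sup>2)) =
    (\<lambda>k. 1 / (w + p * of_nat (Suc k))\<^sup>2 + 1 / (w - p * of_nat (Suc k))\<^sup>2)"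
    unfolding w distrib_left[symmetric] right_diff_distrib[symmetric] power_mult_distrib
    by (simp add: add_divide_distrib mult.commute)
  also have "1 / p\<^sup>2 * ((of_real pi / sin (of_real pi * z))\<^sup>2 - 1 / z\<^sup>2) = csch_half_sq w - 1 / w\<^sup>2"
  proof -
    have "w / 2 = \<i> * (of_real pi * z)" by (simp add: w p_def)
    hence "sinh (w / 2) = - \<i> * sin (\<i> * (\<i> * (of_real pi * z)))" by (simp only: sinh_conv_sin)
    hence "sinh (w / 2) = \<i> * sin (of_real pi * z)" by (simp add: mult.assoc[symmetric])
    thus ?thesis by (simp add: csch_half_sq_def w right_diff_distrib power_mult_distrib power_divide p_def)
  qed
  finally show ?thesis unfolding p_def .
qed

text \<open>The real part bounds \<open>x\<close>; the imaginary part bounds \<open>y\<close> once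
  \<open>x * Im s\<close> has been absorbed by the real part, whence the factor
  \<open>1 + t / e\<close>. Separate bounds in the two coordinates are what a product majorant
  needs.\<close>

lemma norm_lattice_point_ge:
  assumes "Re s > 0"
  obtains c where "c > 0" "\<And>(x::real) (y::real). x \<ge> 0 \<Longrightarrow> c * x \<le> norm (of_real x * s + of_real (2 * pi * y) * \<i>)"
     "\<And>(x::real) (y::real). x \<ge> 0 \<Longrightarrow> c * \<bar>y\<bar> \<le> norm (of_real x * s + of_real (2 * pi * y) * \<i>)"
proof
  define e where "e = Re s"
  define t where "t = \<bar>Im s\<bar>"
  define c where "c = min e (2 * pi / (1 + t / e))"
  have e: "e > 0" "t \<ge> 0" using assms by (auto simp: e_def t_def)
  have d: "1 + t / e > 0" using e by (simp add: add_pos_nonneg)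
  show "c > 0" using e d by (auto simp: c_def)
  fix x y :: real assume x: "x \<ge> 0"
  define W where "W = of_real x * s + of_real (2 * pi * y) * \<i>"
  have re: "e * x \<le> norm W"
    using complex_Re_le_cmod[of W] by (simp add: W_def e_def mult.commute)
  thus "c * x \<le> norm W" using x by (smt (verit) c_def mult_right_mono)
  have "\<bar>x * Im s + 2 * pi * y\<bar> \<le> norm W"
    using abs_Im_le_cmod[of W] by (simp add: W_def)
  moreover have "\<bar>2 * pi * y\<bar> \<le> \<bar>x * Im s + 2 * pi * y\<bar> + \<bar>x * Im s\<bar>" by linarith
  moreover have "\<bar>x * Im s\<bar> = x * t" using x by (simp add: t_def abs_mult)
  moreover have "\<bar>2 * pi * y\<bar> = 2 * pi * \<bar>y\<bar>" by (simp add: abs_mult)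
  moreover have "x * t \<le> norm W * (t / e)"
    using mult_right_mono[OF re, of "t / e"] e by (simp add: field_simps)
  ultimately have "2 * pi * \<bar>y\<bar> \<le> norm W * (1 + t / e)" by (simp add: algebra_simps)
  hence "2 * pi / (1 + t / e) * \<bar>y\<bar> \<le> norm W" using d by (simp add: divide_simps mult_ac)
  thus "c * \<bar>y\<bar> \<le> norm W"
    by (smt (verit) c_def mult_right_mono abs_ge_zero)
qed

lemma cot_ii_times: "cot (\<i> * x) = - \<i> * (1 + exp (- 2 * x)) / (1 - exp (- 2 * x))" for x :: complex
proof -
  have e: "exp (- 2 * x) = exp (- x) * exp (- x)" by (simp flip: exp_add)
  have cs: "cosh x = exp x * (1 + exp (- 2 * x)) / 2" "sinh x = exp x * (1 - exp (- 2 * x)) / 2"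
    unfolding e by (simp_all add: cosh_field_def sinh_field_def algebra_simps flip: exp_add)
  have "cosh x / sinh x = (1 + exp (- 2 * x)) / (1 - exp (- 2 * x))" unfolding cs by simp
  moreover have "cot (\<i> * x) = cosh x / (\<i> * sinh x)"
    by (simp add: cot_def sin_ii_times cosh_conv_cos)
  hence "cot (\<i> * x) = - \<i> * (cosh x / sinh x)" by (simp add: divide_inverse mult_ac)
  ultimately show ?thesis by simp
qed

text \<open>The double series over the lattice points \<open>m s + 2 \<pi> \<i> k\<close> is only conditionally convergent.
  Subtracting from each term its mean over \<open>[k - 1/2, k + 1/2]\<close> makes it absolutely convergent; the
  means contribute nothing if one sums over \<open>k\<close> first, and \<open>1 / (2 s)\<close> if one sums over \<open>m\<close> first.\<close>

theorem csch_half_sq_series_transformation: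
  assumes s: "Re s > 0"
  shows "\<exists>R. (\<lambda>k. 1 / (sinh (2 * of_real pi ^ 2 * of_nat (Suc k) / s))\<^sup>2) sums R \<and>
    (\<lambda>m. csch_half_sq (of_nat (Suc m) * s)) sums
       (of_real pi ^ 2 / (6 * s\<^sup>2) - 1 / (2 * s) + 1 / 24 - of_real pi ^ 2 / s\<^sup>2 * R)"
proof -
  define W where "W = (\<lambda>m (y::real). of_nat (Suc m) * s + of_real (2 * pi * y) * \<i>)"
  define d where "d = (\<lambda>m y. 1 / (W m y)\<^sup>2 - 1 / (W m (y + 1/2) * W m (y - 1/2)))"
  define D where "D = (\<lambda>m k. if k = 0 then d m 0 else d m (real k) + d m (- real k))"
  define C where "C = (\<lambda>m k. if k = 0 then 1 / (W m 0)\<^sup>2 else 1 / (W m (real k))\<^sup>2 + 1 / (W m (- real k))\<^sup>2)"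
  \<comment> \<open>\<open>T m N\<close> is the integral of 1/(W m y)^2 over |y| \<le> N + 1/2, that
    is, the sum of the subtracted means for |k| \<le> N.\<close>
  define T where "T = (\<lambda>m N. (1 / W m (- (real N + 1/2)) - 1 / W m (real N + 1/2)) / (2 * of_real pi * \<i>))"
  have s0: "s \<noteq> 0" using s by auto
  have basel: "(\<lambda>m. 1 / (real (Suc m))\<^sup>2) sums (pi\<^sup>2 / 6)"
    using inverse_squares_sums by (simp add: add.commute)
  obtain c where c: "c > 0" "\<And>(x::real) (y::real). x \<ge> 0 \<Longrightarrow> c * x \<le> norm (of_real x * s + of_real (2 * pi * y) * \<i>)"
     "\<And>(x::real) (y::real). x \<ge> 0 \<Longrightarrow> c * \<bar>y\<bar> \<le> norm (of_real x * s + of_real (2 * pi * y) * \<i>)"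
    using norm_lattice_point_ge[OF s] by blast
  have W1: "c * real (Suc m) \<le> norm (W m y)" and W2: "c * \<bar>y\<bar> \<le> norm (W m y)" for m y
    using c(2)[of "real (Suc m)" y] c(3)[of "real (Suc m)" y] by (simp_all add: W_def)
  have W0: "W m y \<noteq> 0" for m y
    using W1[of m y] c(1) by (smt (verit) mult_pos_pos norm_zero of_nat_0_less_iff zero_less_Suc)
  have W_shift: "W m (y + 1/2) = W m y + of_real pi * \<i>" "W m (y - 1/2) = W m y - of_real pi * \<i>" for m y
    by (simp_all add: W_def algebra_simps)
  have prod_shift: "W m (y + 1/2) * W m (y - 1/2) = (W m y)\<^sup>2 + of_real pi ^ 2" for m y
    unfolding W_shift by (simp add: power2_eq_square algebra_simps)

  have mean: "1 / (W m (y + 1/2) * W m (y - 1/2)) = (1 / W m (y - 1/2) - 1 / W m (y + 1/2)) / (2 * of_real pi * \<i>)" for m y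
  proof -
    have "1 / W m (y - 1/2) - 1 / W m (y + 1/2) = (W m (y + 1/2) - W m (y - 1/2)) / (W m (y + 1/2) * W m (y - 1/2))"
      using W0 by (simp add: diff_frac_eq mult.commute)
    also have "W m (y + 1/2) - W m (y - 1/2) = 2 * of_real pi * \<i>" unfolding W_shift by simp
    finally show ?thesis by simp
  qed
  have sumD: "(\<Sum>k<Suc N. D m k) = (\<Sum>k<Suc N. C m k) - T m N" for m N
  proof (induction N)
    case 0
    show ?case using mean[of m 0] by (simp add: D_def C_def T_def d_def)
  next
    case (Suc N)
    have e: "real (Suc N) + 1/2 = real N + 1 + 1/2" "real (Suc N) - 1/2 = real N + 1/2"
       "- real (Suc N) + 1/2 = - (real N + 1/2)" "- real (Suc N) - 1/2 = - (real N + 1 + 1/2)" by auto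
    have "D m (Suc N) = C m (Suc N) - (1 / (W m (real (Suc N) + 1/2) * W m (real (Suc N) - 1/2)) + 
          1 / (W m (- real (Suc N) + 1/2) * W m (- real (Suc N) - 1/2)))"
      by (simp add: D_def C_def d_def)
    also have "1 / (W m (real (Suc N) + 1/2) * W m (real (Suc N) - 1/2)) + 
          1 / (W m (- real (Suc N) + 1/2) * W m (- real (Suc N) - 1/2)) = T m (Suc N) - T m N"
      unfolding mean unfolding e T_def by (simp add: diff_divide_distrib algebra_simps)
    finally show ?case unfolding sum.lessThan_Suc[of _ "Suc N"] Suc.IH by simp
  qed

  \<comment> \<open>The difference equals pi^2 / (W(y)^2 W(y + 1/2) W(y - 1/2)). Its quartic decay
    is shared out: the square gives the decay in \<open>m\<close>, the two shifted factors the decay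
    in \<open>y\<close>. Excluding 0 < |y| < 1 keeps y \<plusminus> 1/2 away from 0.\<close>
  have normd: "norm (d m y) \<le> 16 * pi\<^sup>2 / c ^ 4 * (1 / (real (Suc m))\<^sup>2) * (1 / (\<bar>y\<bar> + 1)\<^sup>2)"
    if y: "y = 0 \<or> \<bar>y\<bar> \<ge> 1" for m y
  proof -
    have a: "c * (\<bar>y\<bar> + 1) / 4 \<le> norm (W m (y + r))" if r: "r = 1/2 \<or> r = -1/2" for r
    proof (cases "y = 0")
      case True
      have "c * (\<bar>y\<bar> + 1) / 4 \<le> c * real (Suc m)" using c(1) True by simp
      thus ?thesis using W1[of m "y + r"] by linarith
    next
      case False
      hence "(\<bar>y\<bar> + 1) / 4 \<le> \<bar>y + r\<bar>" using y r False by (auto simp: abs_if)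
      hence "c * ((\<bar>y\<bar> + 1) / 4) \<le> c * \<bar>y + r\<bar>" using c(1) by (intro mult_left_mono) auto
      thus ?thesis using W2[of "y + r" m] by (simp)
    qed
    have n0: "W m y \<noteq> 0" "(W m y)\<^sup>2 + of_real pi ^ 2 \<noteq> 0" using W0 prod_shift[of m y] by (metis, metis mult_eq_0_iff)
    have "d m y = of_real pi ^ 2 / ((W m y)\<^sup>2 * (W m (y + 1/2) * W m (y - 1/2)))"
      unfolding d_def prod_shift using n0 by (simp add: diff_frac_eq)
    hence "norm (d m y) = pi\<^sup>2 / ((norm (W m y))\<^sup>2 * (norm (W m (y + 1/2)) * norm (W m (y - 1/2))))"
      by (simp add: norm_divide norm_mult norm_power)
    also have "\<dots> \<le> pi\<^sup>2 / ((c * real (Suc m))\<^sup>2 * ((c * (\<bar>y\<bar> + 1) / 4) * (c * (\<bar>y\<bar> + 1) / 4)))"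
      using a[of "1/2"] a[of "-1/2"] W1[of m y] c(1)
      by (intro divide_left_mono mult_mono power_mono mult_pos_pos zero_less_power) (auto simp: W0)
    also have "\<dots> = 16 * pi\<^sup>2 / c ^ 4 * (1 / (real (Suc m))\<^sup>2) * (1 / (\<bar>y\<bar> + 1)\<^sup>2)"
      by (simp add: power_mult_distrib power2_eq_square power4_eq_xxxx mult_ac)
    finally show ?thesis .
  qed
  define a where "a = (\<lambda>m::nat. 32 * pi\<^sup>2 / c ^ 4 * (1 / (real (Suc m))\<^sup>2))"
  define b where "b = (\<lambda>k::nat. 1 / (real (Suc k))\<^sup>2)"
  have normD: "norm (D m k) \<le> a m * b k" for m k
  proof -
    have k: "k = 0 \<or> Suc 0 \<le> k" by auto
    have x: "norm (d m (real k)) \<le> a m * b k / 2" "norm (d m (- real k)) \<le> a m * b k / 2"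
      using normd[of "real k" m] normd[of "- real k" m] k by (simp_all add: a_def b_def add.commute mult_ac)
    have "a m * b k \<ge> 0" by (simp add: a_def b_def)
    with x show ?thesis using norm_triangle_ineq[of "d m (real k)" "d m (- real k)"]
      by (auto simp: D_def)
  qed
  have sb: "summable b" using basel by (auto simp: b_def sums_iff)
  hence sa: "summable a" unfolding a_def b_def by (intro summable_mult)

  have row: "D m sums csch_half_sq (of_nat (Suc m) * s)" for m
  proof -
    have "(\<lambda>k. C m (Suc k)) sums (csch_half_sq (of_nat (Suc m) * s) - C m 0)"
      using sums_csch_half_sq[of "of_nat (Suc m) * s"] s 
      by (simp add: C_def W_def mult_ac del: of_nat_Suc)
    hence "C m sums csch_half_sq (of_nat (Suc m) * s)" by (subst (asm) sums_Suc_iff) simp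
    hence "(\<lambda>N. \<Sum>k<Suc N. C m k) \<longlonglongrightarrow> csch_half_sq (of_nat (Suc m) * s)"
      unfolding sums_def using LIMSEQ_Suc by blast
    moreover have "T m \<longlonglongrightarrow> 0"
    proof (rule Lim_null_comparison)
      have "norm (T m N) \<le> 4 / c * inverse (real (Suc N))" for N
      proof -
        have "norm (1 / W m y) \<le> 2 / c * inverse (real (Suc N))" if "\<bar>y\<bar> = real N + 1/2" for y
        proof -
          have "c * (real (Suc N) / 2) \<le> c * \<bar>y\<bar>" using c(1) that by (intro mult_left_mono) auto
          hence "c * (real (Suc N) / 2) \<le> norm (W m y)" using W2[of y m] by linarith
          hence "1 / norm (W m y) \<le> 1 / (c * (real (Suc N) / 2))"
            using c(1) W0[of m y] by (intro divide_left_mono mult_pos_pos) auto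
          thus ?thesis by (simp add: norm_divide field_simps)
        qed
        from this[of "- (real N + 1/2)"] this[of "real N + 1/2"]
        have x: "norm (1 / W m (- (real N + 1/2)) - 1 / W m (real N + 1/2)) \<le> 4 / c * inverse (real (Suc N))"
          using norm_triangle_ineq4[of "1 / W m (- (real N + 1/2))" "1 / W m (real N + 1/2)"]
          by (simp add: field_simps)
        have "norm (T m N) \<le> (4 / c * inverse (real (Suc N))) / (2 * pi)"
          unfolding T_def norm_divide[of "_ - _"] using divide_right_mono[OF x, of "2 * pi"] by (simp add: norm_mult)
        also have "\<dots> \<le> (4 / c * inverse (real (Suc N))) / 1"
          using c(1) pi_gt3 by (intro divide_left_mono) auto
        finally show ?thesis by simp
      qed
      thus "\<forall>\<^sub>F N in sequentially. norm (T m N) \<le> 4 / c * inverse (real (Suc N))" by simp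
      show "(\<lambda>N. 4 / c * inverse (real (Suc N))) \<longlonglongrightarrow> 0"
        using tendsto_mult_right_zero[OF LIMSEQ_inverse_real_of_nat] by blast
    qed
    ultimately have "(\<lambda>N. \<Sum>k<Suc N. D m k) \<longlonglongrightarrow> csch_half_sq (of_nat (Suc m) * s) - 0"
      unfolding sumD by (rule tendsto_diff)
    thus ?thesis unfolding sums_def by (subst (asm) filterlim_sequentially_Suc) simp
  qed
  have "summable (\<lambda>m. D m k)" for k
    by (rule summable_comparison_test'[OF summable_mult2[OF sa, of "b k"], of 0]) (use normD in auto)
  hence col: "(\<lambda>m. D m k) sums (\<Sum>m. D m k)" for k by (rule summable_sums)
  obtain S where S1: "(\<lambda>m. csch_half_sq (of_nat (Suc m) * s)) sums S" and S2: "(\<lambda>k. \<Sum>m. D m k) sums S"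
    using sums_swap_dominated[OF normD sa _ sb _ row col] by (auto simp: a_def b_def)

  define h where "h = (\<lambda>k. 1 / (sinh (2 * of_real pi ^ 2 * of_nat (Suc k) / s))\<^sup>2)"
  have nonint: "2 * of_real pi * \<i> * of_real y / s \<notin> \<int>" if "y \<noteq> 0" for y :: real
  proof
    assume "2 * of_real pi * \<i> * of_real y / s \<in> \<int>"
    then obtain j where "2 * of_real pi * \<i> * of_real y / s = of_int j" by (auto elim: Ints_cases)
    hence j: "2 * of_real pi * \<i> * of_real y = of_int j * s" using s0 by (simp add: field_simps)
    hence "Re (2 * of_real pi * \<i> * of_real y) = Re (of_int j * s)" by (rule arg_cong)
    hence "of_int j * Re s = 0" by simp
    hence "j = 0" using s by simp
    with j that show False by simp
  qed
  have C0: "(\<lambda>m. C m 0) sums (of_real pi ^ 2 / (6 * s\<^sup>2))"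
  proof -
    have "(\<lambda>m. complex_of_real (1 / (real (Suc m))\<^sup>2)) sums of_real (pi\<^sup>2 / 6)"
      using basel by (subst sums_of_real_iff)
    from sums_mult[OF this, of "1 / s\<^sup>2"] show ?thesis
      by (simp add: C_def W_def power_mult_distrib mult_ac add.commute)
  qed
  \<comment> \<open>Column \<open>Suc k\<close> is again a series of inverse squares, now in
    \<open>m\<close>, at z = 2 pi i (k + 1) / s. The term m = 0 is missing; it accounts for 1/(4
    pi^2 (k + 1)^2), and these numbers add up to the constant 1/24.\<close>
  have CS: "(\<lambda>m. C m (Suc k)) sums (of_real (1 / (4 * pi\<^sup>2) * (1 / (real (Suc k))\<^sup>2)) - of_real pi ^ 2 / s\<^sup>2 * h k)" for k
  proof -
    define z where "z = 2 * of_real pi * \<i> * of_real (real (Suc k)) / s"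
    have z: "z \<notin> \<int>" unfolding z_def by (rule nonint) simp
    from sums_mult[OF sums_inverse_sin_squared[OF z], of "1 / s\<^sup>2"]
    have "(\<lambda>m. 1 / s\<^sup>2 * (1 / (z + of_nat (Suc m))\<^sup>2 + 1 / (z - of_nat (Suc m))\<^sup>2)) sums 
      (1 / s\<^sup>2 * ((of_real pi / sin (of_real pi * z))\<^sup>2 - 1 / z\<^sup>2))" .
    moreover have "1 / s\<^sup>2 * (1 / (z + of_nat (Suc m))\<^sup>2 + 1 / (z - of_nat (Suc m))\<^sup>2) = C m (Suc k)" for m
    proof -
      have "W m (real (Suc k)) = s * (z + of_nat (Suc m))" "W m (- real (Suc k)) = s * (- (z - of_nat (Suc m)))"
        using s0 by (simp_all add: W_def z_def field_simps)
      thus ?thesis by (simp add: C_def power_mult_distrib add_divide_distrib power2_commute mult.commute del: of_nat_Suc)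
    qed
    moreover have "1 / s\<^sup>2 * ((of_real pi / sin (of_real pi * z))\<^sup>2 - 1 / z\<^sup>2) = 
      of_real (1 / (4 * pi\<^sup>2) * (1 / (real (Suc k))\<^sup>2)) - of_real pi ^ 2 / s\<^sup>2 * h k"
    proof -
      have "of_real pi * z = \<i> * (2 * of_real pi ^ 2 * of_nat (Suc k) / s)"
        by (simp add: z_def power2_eq_square)
      hence "sin (of_real pi * z) = \<i> * sinh (2 * of_real pi ^ 2 * of_nat (Suc k) / s)"
        by (simp only: sin_ii_times)
      hence "(of_real pi / sin (of_real pi * z))\<^sup>2 = - (of_real pi ^ 2 * h k)"
        by (simp add: h_def power_divide power_mult_distrib)
      moreover have "1 / s\<^sup>2 * (1 / z\<^sup>2) = - of_real (1 / (4 * pi\<^sup>2) * (1 / (real (Suc k))\<^sup>2))"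
        using s0 by (simp add: z_def power_mult_distrib power_divide del: of_nat_Suc)
      ultimately show ?thesis by (simp add: right_diff_distrib)
    qed
    ultimately show ?thesis by simp
  qed
  define X where "X = (\<lambda>N. exp (- 4 * of_real pi ^ 2 * of_real (real N + 1/2) / s))"
  have Tsum: "(\<lambda>m. T m N) sums (1 / (2 * of_real pi * \<i> * s) * (s / (2 * of_real pi * \<i> * of_real (real N + 1/2)) + 
      of_real pi * \<i> * (1 + X N) / (1 - X N)))" for N
  proof -
    define y where "y = real N + 1/2"
    define z where "z = 2 * of_real pi * \<i> * of_real y / s"
    have y: "y > 0" by (simp add: y_def)
    have z: "z \<notin> \<int>" unfolding z_def by (rule nonint) (use y in simp)
    from sums_mult[OF sums_cot[OF z], of "1 / (2 * of_real pi * \<i> * s)"]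
    have "(\<lambda>m. 1 / (2 * of_real pi * \<i> * s) * (2 * z / ((of_nat (Suc m))\<^sup>2 - z\<^sup>2))) sums
       (1 / (2 * of_real pi * \<i> * s) * (1 / z - of_real pi * cot (of_real pi * z)))" .
    moreover have "1 / (2 * of_real pi * \<i> * s) * (2 * z / ((of_nat (Suc m))\<^sup>2 - z\<^sup>2)) = T m N" for m
    proof -
      have w: "W m y = s * (of_nat (Suc m) + z)" "W m (- y) = s * (of_nat (Suc m) - z)"
        using s0 by (simp_all add: W_def z_def field_simps)
      have n0: "of_nat (Suc m) + z \<noteq> 0" "of_nat (Suc m) - z \<noteq> 0"
        using W0[of m y] W0[of m "- y"] unfolding w by auto
      have "(of_nat (Suc m))\<^sup>2 - z\<^sup>2 = (of_nat (Suc m) - z) * (of_nat (Suc m) + z)"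
        by (simp add: power2_eq_square algebra_simps)
      moreover have "1 / (of_nat (Suc m) - z) - 1 / (of_nat (Suc m) + z) = 2 * z / ((of_nat (Suc m) - z) * (of_nat (Suc m) + z))"
        using n0 by (subst diff_frac_eq) (auto simp: algebra_simps)
      moreover have "T m N = 1 / (2 * of_real pi * \<i> * s) * (1 / (of_nat (Suc m) - z) - 1 / (of_nat (Suc m) + z))"
        unfolding T_def y_def[symmetric] w using s0 by (simp add: right_diff_distrib diff_divide_distrib mult_ac)
      ultimately show ?thesis by simp
    qed
    moreover have "1 / z - of_real pi * cot (of_real pi * z) = s / (2 * of_real pi * \<i> * of_real y) + 
      of_real pi * \<i> * (1 + X N) / (1 - X N)"
    proof -
      have "of_real pi * z = \<i> * (2 * of_real pi ^ 2 * of_real y / s)"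
        by (simp add: z_def power2_eq_square)
      hence "cot (of_real pi * z) = - \<i> * (1 + X N) / (1 - X N)"
        unfolding X_def y_def[symmetric] using cot_ii_times[of "2 * of_real pi ^ 2 * of_real y / s"] by (simp add: mult.assoc)
      thus ?thesis by (simp add: z_def)
    qed
    ultimately show ?thesis by (simp add: y_def)
  qed
  have Xlim: "X \<longlonglongrightarrow> 0"
  proof -
    have "norm (exp (- 4 * of_real pi ^ 2 / s)) < 1"
    proof -
      have "Re (- 4 * of_real pi ^ 2 / s) = - 4 * pi\<^sup>2 * Re s / (cmod s)\<^sup>2"
        by (simp add: Re_divide cmod_power2 flip: of_real_power)
      also have "\<dots> < 0" using s s0 by (simp add: divide_neg_pos)
      finally show ?thesis by simp
    qed
    from tendsto_mult_right_zero[OF LIMSEQ_power_zero[OF this], of "exp (- 2 * of_real pi ^ 2 / s)"]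
    have "(\<lambda>N. exp (- 2 * of_real pi ^ 2 / s) * exp (- 4 * of_real pi ^ 2 / s) ^ N) \<longlonglongrightarrow> 0" .
    also have "(\<lambda>N. exp (- 2 * of_real pi ^ 2 / s) * exp (- 4 * of_real pi ^ 2 / s) ^ N) = X"
      unfolding X_def exp_of_nat_mult[symmetric] exp_add[symmetric]
      by (intro ext arg_cong[where f = exp]) (use s0 in \<open>simp add: field_simps\<close>)
    finally show ?thesis .
  qed
  \<comment> \<open>As \<open>X N\<close> tends to 0 the cotangent tends to \<open>- \<i>\<close>;
    this limit is the source of the term 1/(2 s) that breaks modularity.\<close>
  have Tlim: "(\<lambda>N. \<Sum>m. T m N) \<longlonglongrightarrow> 1 / (2 * s)"
  proof -
    have l: "(\<lambda>N. s / (2 * of_real pi * \<i> * of_real (real N + 1/2))) \<longlonglongrightarrow> 0"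
    proof (rule Lim_null_comparison)
      show "\<forall>\<^sub>F N in sequentially. norm (s / (2 * of_real pi * \<i> * of_real (real N + 1/2))) \<le> norm s * inverse (real (Suc N))"
      proof (intro always_eventually allI)
        fix N
        have "3 * (real N + 1/2) \<le> pi * (real N + 1/2)" using pi_gt3 by (intro mult_right_mono) auto
        hence "real (Suc N) \<le> 2 * pi * (real N + 1/2)" by simp
        hence "norm s / (2 * pi * (real N + 1/2)) \<le> norm s / real (Suc N)"
          by (intro divide_left_mono) auto
        moreover have "norm (s / (2 * of_real pi * \<i> * of_real y)) = norm s / (2 * pi * y)" if "y > 0" for y
          using that by (simp add: norm_divide norm_mult)
        ultimately show "norm (s / (2 * of_real pi * \<i> * of_real (real N + 1/2))) \<le> norm s * inverse (real (Suc N))"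
          unfolding divide_inverse[symmetric] by (smt (verit) of_nat_0_le_iff divide_pos_pos)
      qed
      show "(\<lambda>N. norm s * inverse (real (Suc N))) \<longlonglongrightarrow> 0"
        using tendsto_mult_right_zero[OF LIMSEQ_inverse_real_of_nat] by blast
    qed
    have "(\<lambda>N. 1 / (2 * of_real pi * \<i> * s) * (s / (2 * of_real pi * \<i> * of_real (real N + 1/2)) + 
      of_real pi * \<i> * (1 + X N) / (1 - X N))) \<longlonglongrightarrow> 1 / (2 * of_real pi * \<i> * s) * (0 + of_real pi * \<i> * (1 + 0) / (1 - 0))"
      by (intro tendsto_intros l Xlim) auto
    moreover have "(\<Sum>m. T m N) = 1 / (2 * of_real pi * \<i> * s) * (s / (2 * of_real pi * \<i> * of_real (real N + 1/2)) + 
      of_real pi * \<i> * (1 + X N) / (1 - X N))" for N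
      using sums_unique[OF Tsum] by simp
    ultimately show ?thesis by simp
  qed

  have Dpart: "(\<Sum>k<Suc N. \<Sum>m. D m k) = of_real pi ^ 2 / (6 * s\<^sup>2) + 
      of_real (\<Sum>k<N. 1 / (4 * pi\<^sup>2) * (1 / (real (Suc k))\<^sup>2)) - of_real pi ^ 2 / s\<^sup>2 * (\<Sum>k<N. h k) - (\<Sum>m. T m N)" for N
  proof -
    have "(\<lambda>m. \<Sum>k<Suc N. D m k) sums (\<Sum>k<Suc N. \<Sum>m. D m k)"
      by (intro sums_sum col)
    moreover have "(\<lambda>m. \<Sum>k<Suc N. D m k) sums (of_real pi ^ 2 / (6 * s\<^sup>2) + 
       (\<Sum>k<N. of_real (1 / (4 * pi\<^sup>2) * (1 / (real (Suc k))\<^sup>2)) - of_real pi ^ 2 / s\<^sup>2 * h k) - (\<Sum>m. T m N))"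
      unfolding sumD unfolding sum.lessThan_Suc_shift
      by (intro sums_diff sums_add sums_sum C0 CS) (use Tsum sums_unique in \<open>auto simp: sums_iff\<close>)
    ultimately have "(\<Sum>k<Suc N. \<Sum>m. D m k) = of_real pi ^ 2 / (6 * s\<^sup>2) + 
       (\<Sum>k<N. of_real (1 / (4 * pi\<^sup>2) * (1 / (real (Suc k))\<^sup>2)) - of_real pi ^ 2 / s\<^sup>2 * h k) - (\<Sum>m. T m N)"
      by (rule sums_unique2)
    thus ?thesis
      unfolding sum_subtractf of_real_sum sum_distrib_left[of "of_real pi ^ 2 / s\<^sup>2" h] by (simp only: add_diff_eq)
  qed
  have zeta: "(\<lambda>N. complex_of_real (\<Sum>k<N. 1 / (4 * pi\<^sup>2) * (1 / (real (Suc k))\<^sup>2))) \<longlonglongrightarrow> of_real (1 / 24)"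
  proof -
    have "(\<lambda>k. 1 / (4 * pi\<^sup>2) * (1 / (real (Suc k))\<^sup>2)) sums (1 / (4 * pi\<^sup>2) * (pi\<^sup>2 / 6))"
      by (intro sums_mult basel)
    thus ?thesis unfolding sums_def by (intro tendsto_of_real) simp
  qed
  have "(\<lambda>N. \<Sum>k<Suc N. \<Sum>m. D m k) \<longlonglongrightarrow> S"
    using S2 unfolding sums_def using LIMSEQ_Suc by blast
  \<comment> \<open>Convergence of the series \<open>h\<close> is not known beforehand. Its partial
    sums are solved for in terms of quantities that converge, which yields convergence and value
    together.\<close>
  hence "(\<lambda>N. s\<^sup>2 / of_real pi ^ 2 * (of_real pi ^ 2 / (6 * s\<^sup>2) + of_real (\<Sum>k<N. 1 / (4 * pi\<^sup>2) * (1 / (real (Suc k))\<^sup>2))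
       - (\<Sum>m. T m N) - (\<Sum>k<Suc N. \<Sum>m. D m k))) \<longlonglongrightarrow> 
     s\<^sup>2 / of_real pi ^ 2 * (of_real pi ^ 2 / (6 * s\<^sup>2) + of_real (1 / 24) - 1 / (2 * s) - S)"
    by (intro tendsto_intros zeta Tlim)
  moreover have "s\<^sup>2 / of_real pi ^ 2 * (of_real pi ^ 2 / (6 * s\<^sup>2) + of_real (\<Sum>k<N. 1 / (4 * pi\<^sup>2) * (1 / (real (Suc k))\<^sup>2))
       - (\<Sum>m. T m N) - (\<Sum>k<Suc N. \<Sum>m. D m k)) = (\<Sum>k<N. h k)" for N
    unfolding Dpart using s0 by simp
  ultimately have "h sums (s\<^sup>2 / of_real pi ^ 2 * (of_real pi ^ 2 / (6 * s\<^sup>2) + of_real (1 / 24) - 1 / (2 * s) - S))"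
    (is "h sums ?R") unfolding sums_def by simp
  moreover have cancel: "of_real pi ^ 2 / s\<^sup>2 * (s\<^sup>2 / of_real pi ^ 2 * x) = x" for x
    using s0 by simp
  have "S = of_real pi ^ 2 / (6 * s\<^sup>2) - 1 / (2 * s) + 1 / 24 - of_real pi ^ 2 / s\<^sup>2 * ?R"
    unfolding cancel by simp
  ultimately show ?thesis using S1 unfolding h_def by metis
qed

section \<open>Size of the transformed series on a vertical line\<close>

lemma power_div_fact_le_sinh:
  fixes a :: real assumes "a \<ge> 0" "odd k" shows "a ^ k / fact k \<le> sinh a"
proof -
  have "(\<Sum>n\<in>{k}. if even n then 0 else a ^ n /\<^sub>R fact n) \<le> sinh a"
    unfolding sums_unique[OF sinh_converges]
    by (rule sum_le_suminf[OF sums_summable[OF sinh_converges]]) (use assms in auto)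
  thus ?thesis using assms by (simp add: field_simps)
qed

lemma norm_sinh_ge: "sinh (Re x) \<le> norm (sinh x)" for x :: complex
proof -
  have "norm (exp x) - norm (exp (- x)) \<le> norm (exp x - exp (- x))" by (rule norm_triangle_ineq2)
  thus ?thesis by (simp add: sinh_field_def norm_divide)
qed

text \<open>The terms decay exponentially in Re(1/s), but this quantity is small far from the real
  axis, so only the power bound \<open>a ^ 5 / 120 \<le> sinh a\<close> is kept, which holds
  everywhere. With exponent p in place of 5 the final contribution against \<open>bin_gen\<close>
  has order 4^n n^(7/2 - p); p has to be odd, and p = 3 would exceed the admissible error.\<close>

lemma norm_csch_half_sq_series_remainder:
  assumes s: "Re s > 0" and R: "(\<lambda>k. 1 / (sinh (2 * of_real pi ^ 2 * of_nat (Suc k) / s))\<^sup>2) sums R"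
    and u: "(norm s)\<^sup>2 \<le> pi\<^sup>2 * u"
  shows "norm (of_real pi ^ 2 / s\<^sup>2 * R) \<le> 24 * u ^ 9 / Re s ^ 10"
proof -
  define e where "e = Re s"
  define v where "v = (norm s)\<^sup>2 / pi\<^sup>2"
  have s0: "s \<noteq> 0" and e: "e > 0" using s by (auto simp: e_def)
  have v: "v > 0" "v \<le> u" using u s0 by (auto simp: v_def field_simps)
  define K where "K = 14400 * (v / (2 * e)) ^ 10"
  have K: "K \<ge> 0" using v e by (simp add: K_def)
  have bnd: "norm (1 / (sinh (2 * of_real pi ^ 2 * of_nat (Suc k) / s))\<^sup>2) \<le> K * (1 / (real (Suc k))\<^sup>2)" for k
  proof -
    define x where "x = 2 * of_real pi ^ 2 * of_nat (Suc k) / s"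
    define a where "a = 2 * e / v * real (Suc k)"
    have "Re x = 2 * pi\<^sup>2 * real (Suc k) * Re s / (norm s)\<^sup>2"
    proof -
      have "x = of_real (2 * pi\<^sup>2 * real (Suc k)) / s" by (simp add: x_def)
      thus ?thesis by (simp only: Re_divide cmod_power2) (simp add: field_simps)
    qed
    also have "\<dots> = a" using s0 by (simp add: a_def v_def e_def)
    finally have "Re x = a" .
    have a: "a > 0" using e v by (simp add: a_def)
    have "a ^ 5 / 120 \<le> norm (sinh x)"
      using power_div_fact_le_sinh[of a 5] norm_sinh_ge[of x] a \<open>Re x = a\<close> by (simp add: fact_numeral)
    hence "(a ^ 5 / 120)\<^sup>2 \<le> (norm (sinh x))\<^sup>2" using a by (intro power_mono) auto
    hence "1 / (norm (sinh x))\<^sup>2 \<le> 1 / (a ^ 5 / 120)\<^sup>2"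
      by (intro frac_le) (use a in auto)
    also have "\<dots> = K * (1 / real (Suc k) ^ 10)"
      using e v by (simp add: a_def K_def power_divide power_mult_distrib flip: power_mult del: of_nat_Suc)
    also have "\<dots> \<le> K * (1 / (real (Suc k))\<^sup>2)"
      using K by (intro mult_left_mono divide_left_mono power_increasing) auto
    finally show ?thesis by (simp add: norm_divide norm_power x_def)
  qed
  have basel: "(\<lambda>m. K * (1 / (real (Suc m))\<^sup>2)) sums (K * (pi\<^sup>2 / 6))"
    using inverse_squares_sums by (intro sums_mult) (simp add: add.commute)
  have "norm R \<le> K * (pi\<^sup>2 / 6)"
    using norm_suminf_le[OF bnd sums_summable[OF basel]] R basel by (simp add: sums_iff)
  hence "norm (of_real pi ^ 2 / s\<^sup>2 * R) \<le> pi\<^sup>2 / (norm s)\<^sup>2 * (K * (pi\<^sup>2 / 6))"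
    unfolding norm_mult norm_divide norm_power by (intro mult_mono) auto
  also have "\<dots> = 2400 / 1024 * pi\<^sup>2 * (v ^ 9 / e ^ 10)"
  proof -
    have "pi\<^sup>2 / (norm s)\<^sup>2 = 1 / v" using s0 by (simp add: v_def)
    moreover have "v ^ 10 = v * v ^ 9" by (simp flip: power_Suc)
    ultimately show ?thesis using v e by (simp add: K_def power_divide power_mult_distrib)
  qed
  also have "\<dots> \<le> 24 * (v ^ 9 / e ^ 10)"
  proof (intro mult_right_mono)
    have "pi\<^sup>2 \<le> 3.1416\<^sup>2" using pi_approx by (intro power_mono) auto
    thus "2400 / 1024 * pi\<^sup>2 \<le> 24" by (simp add: power2_eq_square)
  qed (use v e in auto)
  also have "\<dots> \<le> 24 * (u ^ 9 / e ^ 10)"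
    using v e by (intro mult_left_mono divide_right_mono power_mono) auto
  finally show ?thesis by (simp add: e_def)
qed

section \<open>Lambert series of the divisor function\<close>

text \<open>The pair \<open>(m, d)\<close> stands for the divisor \<open>Suc d\<close> with cofactor
  \<open>Suc m\<close>, so collecting the terms with product k gives sigma(k) exp(- k s). The shift
  by one keeps zero factors out.\<close>

definition lambert :: "complex \<Rightarrow> nat \<times> nat \<Rightarrow> complex" where
  "lambert s = (\<lambda>(m, d). of_nat (Suc d) * exp (- (of_nat (Suc m * Suc d) * s)))"

lemma csch_half_sq_eq: "csch_half_sq w = exp (- w) / (1 - exp (- w))\<^sup>2"
proof -
  have "exp (w / 2) * exp (- w) = exp (- (w / 2))"
    unfolding exp_add[symmetric] by (rule arg_cong[where f = exp]) simp
  hence a: "2 * sinh (w / 2) = exp (w / 2) * (1 - exp (- w))"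
    by (simp add: sinh_field_def right_diff_distrib)
  have b: "exp (w / 2) ^ 2 = exp w"
    unfolding exp_of_nat_mult[symmetric] by simp
  show ?thesis unfolding csch_half_sq_def a power_mult_distrib b by (simp add: exp_minus divide_inverse)
qed

lemma lambert_row:
  assumes "Re s > 0"
  shows "(\<lambda>d. lambert s (m, d)) sums csch_half_sq (of_nat (Suc m) * s)"
proof -
  define q where "q = exp (- (of_nat (Suc m) * s))"
  have "0 < real (Suc m) * Re s" using assms by simp
  hence "norm q < 1" by (simp add: q_def del: of_nat_Suc)
  from sums_mult[OF geometric_deriv_sums[OF this], of q]
  have "(\<lambda>n. q * (of_nat (Suc n) * q ^ n)) sums (q * (1 / (1 - q)\<^sup>2))" .
  moreover have "q * (of_nat (Suc d) * q ^ d) = lambert s (m, d)" for d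
  proof -
    have "exp (- (of_nat (Suc m * Suc d) * s)) = q ^ Suc d"
      unfolding q_def exp_of_nat_mult[symmetric] by (simp add: algebra_simps)
    thus ?thesis unfolding lambert_def prod.case by (simp only: power_Suc mult.left_commute)
  qed
  ultimately show ?thesis unfolding csch_half_sq_eq q_def[symmetric] by simp
qed

lemma norm_lambert: "norm (lambert s (m, d)) = real (Suc d) * exp (real (Suc m * Suc d) * (- Re s))"
  unfolding lambert_def prod.case norm_mult norm_exp_eq_Re norm_of_nat
  by (simp only: uminus_complex.sel times_complex.sel complex_Re_of_nat complex_Im_of_nat mult_zero_left diff_zero mult_minus_right)

lemma lambert_abs_summable:
  assumes "Re s > 0"
  shows "(\<lambda>p. norm (lambert s p)) summable_on UNIV"
proof -
  define x where "x = exp (- Re s)"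
  have x: "0 < x" "x < 1" using assms by (simp_all add: x_def)
  have row: "((\<lambda>d. norm (lambert s (m, d))) has_sum (x ^ Suc m / (1 - x ^ Suc m)\<^sup>2)) UNIV" for m
  proof (rule norm_summable_imp_has_sum)
    have q: "norm (x ^ Suc m) < 1" using x power_Suc_less_one[of x m] by auto
    from sums_mult[OF geometric_deriv_sums[OF q], of "x ^ Suc m"]
    have "(\<lambda>d. x ^ Suc m * (of_nat (Suc d) * (x ^ Suc m) ^ d)) sums (x ^ Suc m * (1 / (1 - x ^ Suc m)\<^sup>2))" .
    moreover have "x ^ Suc m * (of_nat (Suc d) * (x ^ Suc m) ^ d) = norm (lambert s (m, d))" for d
    proof -
      have "norm (lambert s (m, d)) = real (Suc d) * exp (real (Suc m * Suc d) * (- Re s))"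
        by (rule norm_lambert)
      also have "exp (real (Suc m * Suc d) * (- Re s)) = (x ^ Suc m) ^ Suc d"
        unfolding x_def exp_of_nat_mult power_mult ..
      finally show ?thesis by (simp add: mult_ac)
    qed
    ultimately show *: "(\<lambda>d. norm (lambert s (m, d))) sums (x ^ Suc m / (1 - x ^ Suc m)\<^sup>2)" by simp
    show "summable (\<lambda>n. norm (norm (lambert s (m, n))))" using * by (simp add: sums_iff)
  qed
  have "(\<lambda>p. norm (lambert s p)) summable_on (UNIV \<times> UNIV)"
  proof (rule summable_on_SigmaI[OF row])
    have sm: "summable (\<lambda>m. x ^ Suc m / (1 - x)\<^sup>2)"
      using x by (intro summable_divide) (simp add: summable_mult summable_geometric)
    have le: "norm (x ^ Suc m / (1 - x ^ Suc m)\<^sup>2) \<le> x ^ Suc m / (1 - x)\<^sup>2" for m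
    proof -
      have "x ^ Suc m \<le> x" using x power_decreasing[of 1 "Suc m" x] by simp
      hence "x ^ Suc m / (1 - x ^ Suc m)\<^sup>2 \<le> x ^ Suc m / (1 - x)\<^sup>2"
        by (intro frac_le power_mono) (use x in auto)
      thus ?thesis using x by simp
    qed
    have "summable (\<lambda>m. norm (x ^ Suc m / (1 - x ^ Suc m)\<^sup>2))"
      by (rule summable_comparison_test'[OF sm, of 0]) (use le in \<open>simp only: real_norm_def abs_idempotent\<close>)
    thus "(\<lambda>m. x ^ Suc m / (1 - x ^ Suc m)\<^sup>2) summable_on UNIV"
      by (rule norm_summable_imp_summable_on)
  qed auto
  thus ?thesis by (simp only: UNIV_Times_UNIV)
qed

lemma lambert_has_sum:
  assumes "Re s > 0"
  shows "(lambert s has_sum (\<Sum>m. csch_half_sq (of_nat (Suc m) * s))) UNIV"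
proof -
  obtain S where S: "(lambert s has_sum S) (UNIV \<times> UNIV)"
    using abs_summable_summable[OF lambert_abs_summable[OF assms]] by (auto simp: summable_on_def)
  have row: "((\<lambda>d. lambert s (m, d)) has_sum csch_half_sq (of_nat (Suc m) * s)) UNIV" for m
  proof -
    have "(\<lambda>d. lambert s (m, d)) summable_on UNIV"
      using summable_on_SigmaD1[of "\<lambda>m d. lambert s (m, d)" UNIV "\<lambda>_. UNIV" m] S
      by (auto simp: summable_on_def)
    then obtain T where T: "((\<lambda>d. lambert s (m, d)) has_sum T) UNIV" by (auto simp: summable_on_def)
    with lambert_row[OF assms, of m] show ?thesis using has_sum_imp_sums sums_unique2 by metis
  qed
  have "((\<lambda>m. csch_half_sq (of_nat (Suc m) * s)) has_sum S) UNIV"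
    by (rule has_sum_SigmaD[OF S]) (use row in auto)
  hence "S = (\<Sum>m. csch_half_sq (of_nat (Suc m) * s))" by (simp add: has_sum_imp_sums sums_unique)
  with S show ?thesis by simp
qed

text \<open>The norm of a term depends on \<open>s\<close> only through \<open>Re s\<close>, so one
  finite set of indices controls the tail on the whole line. It is enlarged to a square of side at
  least \<open>M\<close>, the shape in which the coefficients are summed later.\<close>

lemma lambert_uniform_partial_sums:
  fixes e \<delta> :: real and M :: nat
  assumes "e > 0" "\<delta> > 0"
  shows "\<exists>N\<ge>M. \<forall>s. Re s = e \<longrightarrow> 
    norm ((\<Sum>m. csch_half_sq (of_nat (Suc m) * s)) - (\<Sum>p\<in>{..<N}\<times>{..<N}. lambert s p)) \<le> \<delta>"
proof -
  define g where "g = (\<lambda>p. norm (lambert (of_real e) p))"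
  have "g summable_on UNIV" unfolding g_def using lambert_abs_summable[of "of_real e"] assms by simp
  then obtain B where B: "(g has_sum B) UNIV" by (auto simp: summable_on_def)
  have "\<forall>\<^sub>F X in finite_subsets_at_top UNIV. dist (sum g X) B < \<delta>"
    using B assms(2) unfolding has_sum_def tendsto_iff by blast
  then obtain X where X: "finite X" "\<And>Y. finite Y \<Longrightarrow> X \<subseteq> Y \<Longrightarrow> dist (sum g Y) B < \<delta>"
    unfolding eventually_finite_subsets_at_top by auto
  obtain N where N: "\<And>p. p \<in> X \<Longrightarrow> fst p < N \<and> snd p < N" "M \<le> N"
  proof
    fix p assume p: "p \<in> X"
    have "fst p \<le> Max (fst ` X)" "snd p \<le> Max (snd ` X)" using p X(1) by auto
    thus "fst p < Suc (M + Max (fst ` X) + Max (snd ` X)) \<and> snd p < Suc (M + Max (fst ` X) + Max (snd ` X))" by simp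
  qed simp
  define Y where "Y = {..<N} \<times> {..<N}"
  have Y: "finite Y" "X \<subseteq> Y" unfolding Y_def using N by (auto simp: mem_Times_iff)
  have "norm ((\<Sum>m. csch_half_sq (of_nat (Suc m) * s)) - sum (lambert s) Y) \<le> \<delta>" if s: "Re s = e" for s
  proof -
    have "(lambert s has_sum ((\<Sum>m. csch_half_sq (of_nat (Suc m) * s)) - sum (lambert s) Y)) (UNIV - Y)"
      using Y s assms by (intro has_sum_Diff lambert_has_sum has_sum_finite) auto
    moreover have "(g has_sum (B - sum g Y)) (UNIV - Y)"
      using Y by (intro has_sum_Diff B has_sum_finite) auto
    moreover have "norm (lambert s p) \<le> g p" for p
      unfolding g_def by (cases p) (simp only: norm_lambert s Re_complex_of_real order_refl)
    ultimately have "norm ((\<Sum>m. csch_half_sq (of_nat (Suc m) * s)) - sum (lambert s) Y) \<le> B - sum g Y"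
      by (rule norm_infsum_le)
    also have "\<dots> \<le> \<delta>" using X(2)[OF Y] by (simp add: dist_real_def)
    finally show ?thesis .
  qed
  thus ?thesis using N(2) by (auto simp: Y_def)
qed

section \<open>Taylor approximations near 0\<close>

lemma cosh_conv_exp: "cosh z = (exp z + exp (- z)) / 2" and sinh_conv_exp: "sinh z = (exp z - exp (- z)) / 2"
  for z :: complex
  by (simp_all add: cosh_field_def sinh_field_def)

lemma norm_cosh_taylor_le:
  fixes z :: complex
  shows "norm (cosh z - ((\<Sum>k\<le>n. z ^ k / fact k) + (\<Sum>k\<le>n. (- z) ^ k / fact k)) / 2)
     \<le> exp \<bar>Re z\<bar> * norm z ^ Suc n / fact n"
proof -
  have "cosh z - ((\<Sum>k\<le>n. z ^ k / fact k) + (\<Sum>k\<le>n. (- z) ^ k / fact k)) / 2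
    = ((exp z - (\<Sum>k\<le>n. z ^ k / fact k)) + (exp (- z) - (\<Sum>k\<le>n. (- z) ^ k / fact k))) / 2"
    by (simp only: cosh_conv_exp diff_divide_distrib add_divide_distrib) (simp only: algebra_simps)
  also have "norm \<dots> \<le> (exp \<bar>Re z\<bar> * norm z ^ Suc n / fact n + exp \<bar>Re z\<bar> * norm z ^ Suc n / fact n) / 2"
    using norm_triangle_le[OF add_mono[OF Taylor_exp[of z n] Taylor_exp[of "- z" n]]]
    by (simp add: norm_divide mult.commute del: power_Suc)
  finally show ?thesis by (simp add: mult_ac)
qed

lemma norm_sinh_taylor_le:
  fixes z :: complex
  shows "norm (sinh z - ((\<Sum>k\<le>n. z ^ k / fact k) - (\<Sum>k\<le>n. (- z) ^ k / fact k)) / 2)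
     \<le> exp \<bar>Re z\<bar> * norm z ^ Suc n / fact n"
proof -
  have "sinh z - ((\<Sum>k\<le>n. z ^ k / fact k) - (\<Sum>k\<le>n. (- z) ^ k / fact k)) / 2
    = ((exp z - (\<Sum>k\<le>n. z ^ k / fact k)) - (exp (- z) - (\<Sum>k\<le>n. (- z) ^ k / fact k))) / 2"
    by (simp only: sinh_conv_exp diff_divide_distrib add_divide_distrib) (simp only: algebra_simps)
  also have "norm \<dots> \<le> (exp \<bar>Re z\<bar> * norm z ^ Suc n / fact n + exp \<bar>Re z\<bar> * norm z ^ Suc n / fact n) / 2"
    using order_trans[OF norm_triangle_ineq4 add_mono[OF Taylor_exp[of z n] Taylor_exp[of "- z" n]]]
    by (simp add: norm_divide mult.commute del: power_Suc)
  finally show ?thesis by (simp add: mult_ac)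
qed

text \<open>The exponential is expanded to degrees 5, 7, 4 and 8: the last term has the wrong parity
  and cancels, so the error gains an order while the polynomial stays the same.\<close>

lemma norm_cosh_taylor6: "norm (cosh z - (1 + z\<^sup>2 / 2 + z ^ 4 / 24)) \<le> exp \<bar>Re z\<bar> * norm z ^ 6 / 120"
  and norm_cosh_taylor8: "norm (cosh z - (1 + z\<^sup>2 / 2 + z ^ 4 / 24 + z ^ 6 / 720)) \<le> exp \<bar>Re z\<bar> * norm z ^ 8 / 5040"
  and norm_sinh_taylor5: "norm (sinh z - (z + z ^ 3 / 6)) \<le> exp \<bar>Re z\<bar> * norm z ^ 5 / 24"
  and norm_sinh_taylor9: "norm (sinh z - (z + z ^ 3 / 6 + z ^ 5 / 120 + z ^ 7 / 5040)) \<le> exp \<bar>Re z\<bar> * norm z ^ 9 / 40320"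
  for z :: complex
  using norm_cosh_taylor_le[of z 5] norm_cosh_taylor_le[of z 7] norm_sinh_taylor_le[of z 4] norm_sinh_taylor_le[of z 8]
  by (simp_all add: atMost_nat_numeral fact_numeral add_divide_distrib add_ac)

lemma exp_small_le:
  fixes x :: real assumes "\<bar>x\<bar> \<le> 1 / 25" shows "exp \<bar>x\<bar> \<le> 21 / 20"
proof -
  have "exp \<bar>x\<bar> \<le> 1 + \<bar>x\<bar> + \<bar>x\<bar>\<^sup>2" by (rule exp_bound) (use assms in auto)
  moreover have "\<bar>x\<bar>\<^sup>2 \<le> (1 / 25)\<^sup>2" using assms by (intro power_mono) auto
  ultimately show ?thesis using assms by (simp add: power2_eq_square)
qed

text \<open>With t = s/2 this is t coth t = 1 + t^2/3 - t^4/45 + 2 t^6/945 - ... . Rather than the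
  tail of this series, \<open>t * cosh t - q * sinh t\<close> is bounded by Taylor remainders and
  divided by \<open>sinh t\<close>, which the third hypothesis keeps comparable with
  \<open>t\<close>. The radius 16/5 exceeds pi + 1/50, so the segment of integration is
  covered.\<close>

lemma coth_taylor:
  fixes s :: complex
  assumes "norm s \<le> 16 / 5" "\<bar>Re s\<bar> \<le> 1 / 50" "norm s \<le> pi * norm (sinh (s / 2))" "s \<noteq> 0"
  shows "norm (s * (cosh (s / 2) / (2 * sinh (s / 2))) - (1 + s\<^sup>2 / 12 - s ^ 4 / 720 + s ^ 6 / 30240)) \<le> norm s ^ 8 / 250000"
proof -
  define t where "t = s / 2"
  have st: "s = 2 * t" by (simp add: t_def)
  have t0: "t \<noteq> 0" and tn: "norm t \<le> 8 / 5" and tr: "\<bar>Re t\<bar> \<le> 1 / 25"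
    using assms by (auto simp: t_def norm_divide)
  have "norm s \<le> (10 / 3) * norm (sinh t)"
  proof -
    have "pi * norm (sinh t) \<le> (10 / 3) * norm (sinh t)" using pi_approx by (intro mult_right_mono) auto
    thus ?thesis using assms(3) by (simp add: t_def)
  qed
  hence sh: "3 / 5 * norm t \<le> norm (sinh t)" by (simp add: st norm_mult)
  hence sh0: "sinh t \<noteq> 0" using t0 by auto
  define q where "q = 1 + t\<^sup>2 / 3 - t ^ 4 / 45 + 2 * t ^ 6 / 945"
  define r1 where "r1 = cosh t - (1 + t\<^sup>2 / 2 + t ^ 4 / 24 + t ^ 6 / 720)"
  define r2 where "r2 = sinh t - (t + t ^ 3 / 6 + t ^ 5 / 120 + t ^ 7 / 5040)"
  have e: "exp \<bar>Re t\<bar> \<le> 21 / 20" by (rule exp_small_le[OF tr])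
  have r1: "norm r1 \<le> 1 / 4800 * norm t ^ 8"
    using norm_cosh_taylor8[of t] mult_right_mono[OF e, of "norm t ^ 8"] by (simp add: r1_def)
  have r2: "norm r2 \<le> 1 / 38400 * norm t ^ 9"
    using norm_sinh_taylor9[of t] mult_right_mono[OF e, of "norm t ^ 9"] by (simp add: r2_def)
  have tp: "norm t ^ k \<le> (8 / 5) ^ k" for k using tn by (intro power_mono) auto
  have q: "norm q \<le> 5 / 2"
  proof -
    have "norm q \<le> norm (1 + t\<^sup>2 / 3 - t ^ 4 / 45) + norm (2 * t ^ 6 / 945)" unfolding q_def by (rule norm_triangle_ineq)
    also have "norm (1 + t\<^sup>2 / 3 - t ^ 4 / 45) \<le> norm (1 + t\<^sup>2 / 3) + norm (t ^ 4 / 45)" by (rule norm_triangle_ineq4)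
    also have "norm (1 + t\<^sup>2 / 3) \<le> norm (1::complex) + norm (t\<^sup>2 / 3)" by (rule norm_triangle_ineq)
    finally show ?thesis using tp[of 2] tp[of 4] tp[of 6]
      by (simp add: norm_divide norm_power norm_mult power_divide)
  qed
  \<comment> \<open>\<open>q\<close> cancels every power of \<open>t\<close> below the ninth in the
    difference of the Taylor polynomials; the three terms of degrees 9, 11 and 13 are the overflow
    of the product.\<close>
  have eq: "t * cosh t - q * sinh t = t * r1 - q * r2 + t ^ 9 * (- 53 / 226800 - t\<^sup>2 / 75600 - 2 * t ^ 4 / 4762800)"
  proof -
    have "cosh t = (1 + t\<^sup>2 / 2 + t ^ 4 / 24 + t ^ 6 / 720) + r1" "sinh t = (t + t ^ 3 / 6 + t ^ 5 / 120 + t ^ 7 / 5040) + r2"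
      by (simp_all add: r1_def r2_def)
    moreover have "t * (1 + t\<^sup>2 / 2 + t ^ 4 / 24 + t ^ 6 / 720) - q * (t + t ^ 3 / 6 + t ^ 5 / 120 + t ^ 7 / 5040)
      = t ^ 9 * (- 53 / 226800 - t\<^sup>2 / 75600 - 2 * t ^ 4 / 4762800)"
      unfolding q_def by (simp add: field_simps eval_nat_numeral)
    ultimately show ?thesis by (simp add: algebra_simps)
  qed
  have "norm (- 53 / 226800 - t\<^sup>2 / 75600 - 2 * t ^ 4 / 4762800) \<le> 1 / 3500"
  proof -
    have "norm (- 53 / 226800 - t\<^sup>2 / 75600 - 2 * t ^ 4 / 4762800) \<le> norm (- 53 / 226800 - t\<^sup>2 / 75600) + norm (2 * t ^ 4 / 4762800)" by (rule norm_triangle_ineq4)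
    also have "norm (- 53 / 226800 - t\<^sup>2 / 75600) \<le> norm (- 53 / 226800 :: complex) + norm (t\<^sup>2 / 75600)" by (rule norm_triangle_ineq4)
    finally show ?thesis using tp[of 2] tp[of 4]
      by (simp add: norm_divide norm_power norm_mult power_divide)
  qed
  hence p: "norm (t ^ 9 * (- 53 / 226800 - t\<^sup>2 / 75600 - 2 * t ^ 4 / 4762800)) \<le> norm t ^ 9 * (1 / 3500)"
    unfolding norm_mult[of "t ^ 9"] norm_power by (intro mult_left_mono) auto
  have "norm (t * r1) \<le> norm t * (1 / 4800 * norm t ^ 8)" unfolding norm_mult by (intro mult_left_mono r1) auto
  moreover have "norm (q * r2) \<le> 5 / 2 * (1 / 38400 * norm t ^ 9)" unfolding norm_mult by (intro mult_mono q r2) auto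
  moreover have "norm t * (1 / 4800 * norm t ^ 8) = 1 / 4800 * norm t ^ 9" by (simp flip: power_Suc)
  moreover have "norm (t * cosh t - q * sinh t) \<le> norm (t * r1) + norm (q * r2) + norm (t ^ 9 * (- 53 / 226800 - t\<^sup>2 / 75600 - 2 * t ^ 4 / 4762800))"
    unfolding eq using norm_triangle_ineq norm_triangle_ineq4 by (smt (verit))
  ultimately have main: "norm (t * cosh t - q * sinh t) \<le> 6 / 10000 * norm t ^ 9" using p zero_le_power[OF norm_ge_zero[of t], of 9] by linarith
  have "s * (cosh t / (2 * sinh t)) - q = (t * cosh t - q * sinh t) / sinh t"
    using sh0 by (simp add: st field_simps)
  hence "norm (s * (cosh t / (2 * sinh t)) - q) = norm (t * cosh t - q * sinh t) / norm (sinh t)"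
    by (simp add: norm_divide)
  also have "\<dots> \<le> (6 / 10000 * norm t ^ 9) / (3 / 5 * norm t)"
    by (intro frac_le main sh) (use t0 in auto)
  also have "\<dots> = norm t ^ 8 / 1000"
  proof -
    have "norm t ^ 9 = norm t * norm t ^ 8" by (simp flip: power_Suc)
    thus ?thesis using t0 by simp
  qed
  also have "\<dots> \<le> norm s ^ 8 / 250000" by (simp add: st norm_mult power_mult_distrib)
  also have "q = 1 + s\<^sup>2 / 12 - s ^ 4 / 720 + s ^ 6 / 30240"
    by (simp add: q_def st power_mult_distrib)
  finally show ?thesis by (simp add: t_def)
qed

lemma csch_half_sq_conv_coth:
  fixes s :: complex assumes "sinh (s / 2) \<noteq> 0"
  shows "csch_half_sq s = (cosh (s / 2) / (2 * sinh (s / 2)))\<^sup>2 - 1 / 4"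
proof -
  have "(cosh (s / 2))\<^sup>2 = (sinh (s / 2))\<^sup>2 + 1" by (rule cosh_square_eq)
  thus ?thesis using assms by (simp add: csch_half_sq_def power_divide power_mult_distrib field_simps)
qed

text \<open>By the identity between csch and coth, s^2 times the left side comes from squaring the
  expansion of \<open>s * H\<close>; the final division by s^2 turns an error of order 8 into one of
  order 6.\<close>

lemma csch_half_sq_taylor:
  fixes s :: complex
  assumes "norm s \<le> 16 / 5" "\<bar>Re s\<bar> \<le> 1 / 50" "norm s \<le> pi * norm (sinh (s / 2))" "s \<noteq> 0"
  shows "norm (1 / s\<^sup>2 - csch_half_sq s - (1 / 12 - s\<^sup>2 / 240 + s ^ 4 / 6048)) \<le> norm s ^ 6 / 30000"
proof -
  define H where "H = cosh (s / 2) / (2 * sinh (s / 2))"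
  define q where "q = 1 + s\<^sup>2 / 12 - s ^ 4 / 720 + s ^ 6 / 30240"
  define \<rho> where "\<rho> = s * H - q"
  have sp: "norm s ^ k \<le> (16 / 5) ^ k" for k using assms by (intro power_mono) auto
  have \<rho>: "norm \<rho> \<le> norm s ^ 8 / 250000" unfolding \<rho>_def H_def q_def by (rule coth_taylor[OF assms])
  have q: "norm q \<le> 5 / 2"
  proof -
    have "norm q \<le> norm (1 + s\<^sup>2 / 12 - s ^ 4 / 720) + norm (s ^ 6 / 30240)" unfolding q_def by (rule norm_triangle_ineq)
    also have "norm (1 + s\<^sup>2 / 12 - s ^ 4 / 720) \<le> norm (1 + s\<^sup>2 / 12) + norm (s ^ 4 / 720)" by (rule norm_triangle_ineq4)
    also have "norm (1 + s\<^sup>2 / 12) \<le> norm (1::complex) + norm (s\<^sup>2 / 12)" by (rule norm_triangle_ineq)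
    finally show ?thesis using sp[of 2] sp[of 4] sp[of 6]
      by (simp add: norm_divide norm_power norm_mult power_divide)
  qed
  have sh: "sinh (s / 2) \<noteq> 0" using assms(3,4) by auto
  \<comment> \<open>\<open>s ^ 8 * p\<close> is the part of q^2 of degree 8 and more; the lower
    degrees match the claimed polynomial.\<close>
  define p where "p = 1 / 518400 + 1 / 181440 - s\<^sup>2 / 10886400 + s ^ 4 / 914457600"
  define e1 where "e1 = 1 / s\<^sup>2 - csch_half_sq s - (1 / 12 - s\<^sup>2 / 240 + s ^ 4 / 6048)"
  have e1: "s\<^sup>2 * e1 = - (s ^ 8 * p) - \<rho> * (2 * q + \<rho>)"
  proof -
    have "s\<^sup>2 * csch_half_sq s = (s * H)\<^sup>2 - s\<^sup>2 / 4"
      unfolding csch_half_sq_conv_coth[OF sh] H_def[symmetric] by (simp add: algebra_simps power_mult_distrib)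
    also have "s * H = q + \<rho>" by (simp add: \<rho>_def)
    finally have "s\<^sup>2 * csch_half_sq s = (q + \<rho>)\<^sup>2 - s\<^sup>2 / 4" .
    hence "s\<^sup>2 * e1 = 1 - ((q + \<rho>)\<^sup>2 - s\<^sup>2 / 4) - s\<^sup>2 * (1 / 12 - s\<^sup>2 / 240 + s ^ 4 / 6048)"
      using assms(4) by (simp add: e1_def right_diff_distrib)
    also have "\<dots> = (1 + s\<^sup>2 / 4 - s\<^sup>2 * (1 / 12 - s\<^sup>2 / 240 + s ^ 4 / 6048) - q\<^sup>2) - \<rho> * (2 * q + \<rho>)"
      by (simp add: power2_eq_square algebra_simps)
    also have "1 + s\<^sup>2 / 4 - s\<^sup>2 * (1 / 12 - s\<^sup>2 / 240 + s ^ 4 / 6048) - q\<^sup>2 = - (s ^ 8 * p)"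
      unfolding q_def p_def by (simp add: field_simps eval_nat_numeral)
    finally show ?thesis .
  qed
  have p: "norm p \<le> 1 / 100000"
  proof -
    have "norm p \<le> norm (1 / 518400 + 1 / 181440 - s\<^sup>2 / 10886400) + norm (s ^ 4 / 914457600)"
      unfolding p_def by (rule norm_triangle_ineq)
    also have "norm (1 / 518400 + 1 / 181440 - s\<^sup>2 / 10886400) \<le> norm (1 / 518400 + 1 / 181440 :: complex) + norm (s\<^sup>2 / 10886400)" by (rule norm_triangle_ineq4)
    finally show ?thesis using sp[of 2] sp[of 4]
      by (simp add: norm_divide norm_power norm_mult power_divide)
  qed
  have "norm (2 * q + \<rho>) \<le> 51 / 10"
  proof -
    have "norm \<rho> \<le> 1 / 10" using \<rho> sp[of 8] by (simp add: power_divide)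
    thus ?thesis using norm_triangle_ineq[of "2 * q" \<rho>] q by (simp add: norm_mult)
  qed
  hence "norm (\<rho> * (2 * q + \<rho>)) \<le> norm s ^ 8 / 250000 * (51 / 10)"
    unfolding norm_mult by (intro mult_mono \<rho>) auto
  moreover have "norm (s ^ 8 * p) \<le> norm s ^ 8 * (1 / 100000)"
    unfolding norm_mult norm_power by (intro mult_left_mono p) auto
  moreover have "norm (s\<^sup>2 * e1) \<le> norm (s ^ 8 * p) + norm (\<rho> * (2 * q + \<rho>))"
    unfolding e1 using norm_triangle_ineq4[of "- (s ^ 8 * p)"] by simp
  ultimately have "norm (s\<^sup>2 * e1) \<le> norm s ^ 8 / 30000"
    using zero_le_power[OF norm_ge_zero[of s], of 8] by linarith
  hence "(norm s)\<^sup>2 * norm e1 \<le> norm s ^ (2 + 6) / 30000" by (simp add: norm_mult norm_power)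
  hence "(norm s)\<^sup>2 * norm e1 \<le> (norm s)\<^sup>2 * (norm s ^ 6 / 30000)" unfolding power_add by simp
  thus ?thesis unfolding e1_def[symmetric] by (rule mult_left_le_imp_le) (use assms(4) in auto)
qed

text \<open>The coefficients make the Taylor expansions agree through \<open>s\<^sup>4\<close>.\<close>

lemma trig_approximation:
  fixes s :: complex
  assumes "norm s \<le> 16 / 5" "\<bar>Re s\<bar> \<le> 1 / 50" "norm s \<le> pi * norm (sinh (s / 2))" "s \<noteq> 0"
  shows "norm (of_real (pi\<^sup>2 / 6) * (1 / s\<^sup>2 - csch_half_sq s) + (cosh (s / 2) / (2 * sinh (s / 2)) - 1 / s) / 2
    - (of_real (pi\<^sup>2 / 6) * (191 / 2016 - 47 / 3780 * cosh s + 31 / 30240 * cosh (2 * s))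
       + 41 / 720 * sinh s - 11 / 1440 * sinh (2 * s))) \<le> norm s ^ 5 / 50"
proof -
  define H where "H = cosh (s / 2) / (2 * sinh (s / 2))"
  define x where "x = norm s ^ 5"
  define e1 where "e1 = 1 / s\<^sup>2 - csch_half_sq s - (1 / 12 - s\<^sup>2 / 240 + s ^ 4 / 6048)"
  define \<rho> where "\<rho> = s * H - (1 + s\<^sup>2 / 12 - s ^ 4 / 720 + s ^ 6 / 30240)"
  define e2 where "e2 = (H - 1 / s) / 2 - (s / 24 - s ^ 3 / 1440)"
  define e3 where "e3 = cosh s - (1 + s\<^sup>2 / 2 + s ^ 4 / 24)"
  define e4 where "e4 = cosh (2 * s) - (1 + (2 * s)\<^sup>2 / 2 + (2 * s) ^ 4 / 24)"
  define e5 where "e5 = sinh s - (s + s ^ 3 / 6)"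
  define e6 where "e6 = sinh (2 * s) - (2 * s + (2 * s) ^ 3 / 6)"
  have sp: "norm s ^ k \<le> (16 / 5) ^ k" for k using assms by (intro power_mono) auto
  have x0: "x \<ge> 0" by (simp add: x_def)
  have x6: "norm s ^ 6 \<le> 16 / 5 * x"
    using mult_right_mono[OF assms(1), of x] by (simp add: x_def flip: power_Suc)
  have E1: "norm e1 \<le> x / 9000" using csch_half_sq_taylor[OF assms] x6 x0 by (simp add: e1_def)
  have E2: "norm e2 \<le> x / 10000"
  proof -
    have \<rho>: "norm \<rho> \<le> norm s ^ 8 / 250000" unfolding \<rho>_def H_def by (rule coth_taylor[OF assms])
    have "s * e2 = \<rho> / 2 + s ^ 6 / 60480"
      using assms(4) unfolding e2_def \<rho>_def by (simp add: field_simps eval_nat_numeral)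
    hence "norm (s * e2) \<le> norm \<rho> / 2 + norm s ^ 6 / 60480"
      using norm_triangle_ineq[of "\<rho> / 2" "s ^ 6 / 60480"] by (simp add: norm_divide norm_power)
    moreover have "norm s ^ 8 \<le> (16 / 5)\<^sup>2 * norm s ^ 6"
      using mult_right_mono[OF sp[of 2], of "norm s ^ 6"] by (simp flip: power_add)
    hence "norm \<rho> \<le> 256 / 25 * norm s ^ 6 / 250000" using \<rho> by (simp add: power2_eq_square)
    ultimately have "norm (s * e2) \<le> norm s ^ 6 / 10000"
      using zero_le_power[OF norm_ge_zero[of s], of 6] by linarith
    hence "norm (s * e2) \<le> norm s ^ Suc 5 / 10000" by simp
    hence "norm s * norm e2 \<le> norm s * (x / 10000)" unfolding norm_mult power_Suc x_def by simp
    thus ?thesis by (rule mult_left_le_imp_le) (use assms(4) in auto)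
  qed
  have "\<bar>Re s\<bar> \<le> 1 / 25" "\<bar>Re (2 * s)\<bar> \<le> 1 / 25" using assms(2) by (simp_all add: abs_mult)
  note ex = this[THEN exp_small_le]
  have E3: "norm e3 \<le> 7 / 250 * x"
  proof -
    have "norm e3 \<le> exp \<bar>Re s\<bar> * norm s ^ 6 / 120" unfolding e3_def by (rule norm_cosh_taylor6)
    also have "\<dots> \<le> 21 / 20 * (16 / 5 * x) / 120" by (intro divide_right_mono mult_mono ex x6) auto
    finally show ?thesis by simp
  qed
  have E4: "norm e4 \<le> 9 / 5 * x"
  proof -
    have "norm e4 \<le> exp \<bar>Re (2 * s)\<bar> * norm (2 * s) ^ 6 / 120" unfolding e4_def by (rule norm_cosh_taylor6)
    also have "norm (2 * s) ^ 6 = 64 * norm s ^ 6" by (simp add: norm_mult power_mult_distrib)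
    also have "exp \<bar>Re (2 * s)\<bar> * (64 * norm s ^ 6) / 120 \<le> 21 / 20 * (64 * (16 / 5 * x)) / 120" 
      by (intro divide_right_mono mult_mono ex mult_left_mono x6) auto
    finally show ?thesis using x0 by simp
  qed
  have E5: "norm e5 \<le> 7 / 160 * x"
  proof -
    have "norm e5 \<le> exp \<bar>Re s\<bar> * norm s ^ 5 / 24" unfolding e5_def by (rule norm_sinh_taylor5)
    also have "\<dots> \<le> 21 / 20 * norm s ^ 5 / 24" by (intro divide_right_mono mult_right_mono ex) auto
    finally show ?thesis by (simp add: x_def)
  qed
  have E6: "norm e6 \<le> 7 / 5 * x"
  proof -
    have "norm e6 \<le> exp \<bar>Re (2 * s)\<bar> * norm (2 * s) ^ 5 / 24" unfolding e6_def by (rule norm_sinh_taylor5)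
    also have "\<dots> \<le> 21 / 20 * norm (2 * s) ^ 5 / 24" by (intro divide_right_mono mult_right_mono ex) auto
    finally show ?thesis by (simp add: x_def norm_mult power_mult_distrib)
  qed
  define P where "P = complex_of_real (pi\<^sup>2 / 6)"
  have P: "norm P \<le> 5 / 3"
  proof -
    have "pi\<^sup>2 \<le> 3.1416\<^sup>2" using pi_approx by (intro power_mono) auto
    thus ?thesis unfolding P_def norm_of_real by (simp add: power2_eq_square)
  qed
  have ch: "cosh s = e3 + (1 + s\<^sup>2 / 2 + s ^ 4 / 24)" "cosh (2 * s) = e4 + (1 + (2 * s)\<^sup>2 / 2 + (2 * s) ^ 4 / 24)"
    "sinh s = e5 + (s + s ^ 3 / 6)" "sinh (2 * s) = e6 + (2 * s + (2 * s) ^ 3 / 6)"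
    "1 / s\<^sup>2 - csch_half_sq s = e1 + (1 / 12 - s\<^sup>2 / 240 + s ^ 4 / 6048)" "(H - 1 / s) / 2 = e2 + (s / 24 - s ^ 3 / 1440)"
    by (simp_all add: e1_def e2_def e3_def e4_def e5_def e6_def)
  have "P * (1 / s\<^sup>2 - csch_half_sq s) + (H - 1 / s) / 2
    - (P * (191 / 2016 - 47 / 3780 * cosh s + 31 / 30240 * cosh (2 * s)) + 41 / 720 * sinh s - 11 / 1440 * sinh (2 * s))
    = P * (e1 + 47 / 3780 * e3 - 31 / 30240 * e4) + e2 - 41 / 720 * e5 + 11 / 1440 * e6"
    unfolding ch by (simp add: field_simps)
  also have "norm \<dots> \<le> norm P * (norm e1 + 47 / 3780 * norm e3 + 31 / 30240 * norm e4) + norm e2 + 41 / 720 * norm e5 + 11 / 1440 * norm e6"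
  proof -
    have "norm (e1 + 47 / 3780 * e3 - 31 / 30240 * e4) \<le> norm e1 + 47 / 3780 * norm e3 + 31 / 30240 * norm e4"
      using norm_triangle_ineq4[of "e1 + 47 / 3780 * e3" "31 / 30240 * e4"] norm_triangle_ineq[of e1 "47 / 3780 * e3"]
      by (simp add: norm_mult)
    hence "norm (P * (e1 + 47 / 3780 * e3 - 31 / 30240 * e4)) \<le> norm P * (norm e1 + 47 / 3780 * norm e3 + 31 / 30240 * norm e4)"
      unfolding norm_mult by (intro mult_left_mono) auto
    thus ?thesis
      using norm_triangle_ineq[of "P * (e1 + 47 / 3780 * e3 - 31 / 30240 * e4) + e2 - 41 / 720 * e5" "11 / 1440 * e6"]
        norm_triangle_ineq4[of "P * (e1 + 47 / 3780 * e3 - 31 / 30240 * e4) + e2" "41 / 720 * e5"]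
        norm_triangle_ineq[of "P * (e1 + 47 / 3780 * e3 - 31 / 30240 * e4)" e2]
      by (simp add: norm_mult)
  qed
  also have "\<dots> \<le> 5 / 3 * (x / 9000 + 47 / 3780 * (7 / 250 * x) + 31 / 30240 * (9 / 5 * x)) + x / 10000 + 41 / 720 * (7 / 160 * x) + 11 / 1440 * (7 / 5 * x)"
    using x0 by (intro add_mono mult_mono P E1 E2 E3 E4 E5 E6) auto
  also have "\<dots> \<le> x / 50" using x0 by (simp add: field_simps)
  finally show ?thesis by (simp add: H_def P_def x_def)
qed

section \<open>The weighted binomial generating function\<close>

text \<open>This is z^r / r! times the r-th derivative of (1 + z)^M, obtained by exchanging the
  order of the two choices.\<close>

lemma sum_choose_choose:
  fixes z :: "'a :: comm_ring_1"
  assumes "r \<le> M"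
  shows "(\<Sum>j\<le>M. of_nat (j choose r) * of_nat (M choose j) * z ^ j) = of_nat (M choose r) * z ^ r * (1 + z) ^ (M - r)"
proof -
  have "(\<Sum>j\<le>M. of_nat (j choose r) * of_nat (M choose j) * z ^ j)
      = (\<Sum>j\<in>{r..M}. of_nat (j choose r) * of_nat (M choose j) * z ^ j)"
    by (intro sum.mono_neutral_right) (auto simp: binomial_eq_0)
  also have "\<dots> = (\<Sum>i\<le>M - r. of_nat ((i + r) choose r) * of_nat (M choose (i + r)) * z ^ (i + r))"
    by (rule sum.reindex_bij_witness[of _ "\<lambda>i. i + r" "\<lambda>j. j - r"]) (use assms in auto)
  also have "\<dots> = (\<Sum>i\<le>M - r. of_nat (M choose r) * z ^ r * (of_nat ((M - r) choose i) * z ^ i))"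
  proof (rule sum.cong[OF refl])
    fix i assume "i \<in> {..M - r}"
    hence "(M choose (i + r)) * ((i + r) choose r) = (M choose r) * ((M - r) choose i)"
      using choose_mult[of r "i + r" M] assms by simp
    hence "of_nat ((i + r) choose r) * of_nat (M choose (i + r)) = (of_nat (M choose r) * of_nat ((M - r) choose i) :: 'a)"
      by (metis mult.commute of_nat_mult)
    thus "of_nat ((i + r) choose r) * of_nat (M choose (i + r)) * z ^ (i + r) = of_nat (M choose r) * z ^ r * (of_nat ((M - r) choose i) * z ^ i)"
      by (simp add: power_add mult_ac)
  qed
  also have "\<dots> = of_nat (M choose r) * z ^ r * (1 + z) ^ (M - r)"
    using binomial_ring[of z 1 "M - r"] by (simp add: sum_distrib_left add.commute)
  finally show ?thesis .
qed

lemma falling_factorials_of_nat: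
  fixes j :: nat
  defines "x \<equiv> (of_nat j :: complex)"
  shows "of_nat (j choose 2) * 2 = x * (x - 1)"
    "of_nat (j choose 3) * 6 = x * (x - 1) * (x - 2)"
    "of_nat (j choose 4) * 24 = x * (x - 1) * (x - 2) * (x - 3)"
    "of_nat (j choose 5) * 120 = x * (x - 1) * (x - 2) * (x - 3) * (x - 4)"
  unfolding x_def binomial_gbinomial gbinomial_prod_rev
  by (simp_all add: atLeast0LessThan lessThan_nat_numeral fact_numeral mult_ac)

definition bin_weight :: "nat \<Rightarrow> int \<Rightarrow> real" where
  "bin_weight n k = of_int k * ((of_int k)\<^sup>2 - 3 * of_nat n + 2) * (2 * (of_int k)\<^sup>2 - of_nat n) * of_nat ((2 * n) choose nat (int n + k))"

definition bin_gen :: "nat \<Rightarrow> complex \<Rightarrow> complex" where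
  "bin_gen n s = (\<Sum>j\<le>2 * n. of_real (bin_weight n (int j - int n)) * exp (of_int (int j - int n) * s))"

text \<open>In falling factorials of j = n + k the weight turns the binomial sum into multiples of
  z^r (1 + z)^(2n - r) with r \<le> 5, which share the factor (1 + z)^(2n - 5). The triple zero at s
  = 0 reflects that the weights are odd in k and that their first moment vanishes.\<close>

lemma bin_gen_eq:
  assumes "n \<ge> 3"
  shows "bin_gen n s * exp (of_nat n * s) = of_real (real n * (real n - 1) * (real n - 2) * (2 * real n - 1)) *
     ((exp s - 1) ^ 3 * (1 + exp s) ^ (2 * n - 5) * (6 * exp s + of_nat n * (exp s - 1)\<^sup>2))"
proof -
  define N where "N = (of_nat n :: complex)"
  define z where "z = exp s"
  define B where "B = (\<lambda>r. \<Sum>j\<le>2 * n. of_nat (j choose r) * of_nat ((2 * n) choose j) * z ^ j)"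
  define m where "m = 2 * n - 5"
  define y where "y = (1 + z) ^ m"
  have lin: "(a0 * b0 + a1 * b1 + a2 * (b2 * 2) + a3 * (b3 * 6) + a4 * (b4 * 24) + 2 * (b5 * 120)) * w * v =
      a0 * (b0 * w * v) + a1 * (b1 * w * v) + a2 * (b2 * w * v * 2) + a3 * (b3 * w * v * 6)
      + a4 * (b4 * w * v * 24) + 2 * (b5 * w * v * 120)" for a0 a1 a2 a3 a4 b0 b1 b2 b3 b4 b5 w v :: complex
    by algebra
  have "exp (of_int (int j - int n) * s) * exp (of_nat n * s) = z ^ j" for j
    unfolding exp_add[symmetric] z_def exp_of_nat_mult[symmetric]
    by (rule arg_cong[where f = exp]) (simp add: algebra_simps)
  hence "bin_gen n s * exp (of_nat n * s) = (\<Sum>j\<le>2 * n. of_real (bin_weight n (int j - int n)) * z ^ j)"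
    unfolding bin_gen_def sum_distrib_right by (simp only: mult.assoc)
  \<comment> \<open>The six polynomials in \<open>N\<close> are the coordinates of the weight in the
    basis of falling factorials of \<open>j\<close>; the factors 2, 6, 24, 120 convert binomial
    coefficients into falling factorials.\<close>
  also have "\<dots> = (\<Sum>j\<le>2 * n. ((2*N^2 - 7*N^3 + 7*N^4 - 2*N^5) * of_nat (j choose 0) + (6 - 31*N + 56*N^2 - 41*N^3 + 10*N^4) * of_nat (j choose 1)
     + (42 - 103*N + 81*N^2 - 20*N^3) * (of_nat (j choose 2) * 2) + (54 - 67*N + 20*N^2) * (of_nat (j choose 3) * 6)
     + (20 - 10*N) * (of_nat (j choose 4) * 24) + 2 * (of_nat (j choose 5) * 120)) * of_nat ((2 * n) choose j) * z ^ j)"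
  proof (rule sum.cong[OF refl])
    fix j
    define x where "x = (of_nat j :: complex)"
    have "complex_of_real (bin_weight n (int j - int n)) = (x - N) * ((x - N)\<^sup>2 - 3 * N + 2) * (2 * (x - N)\<^sup>2 - N) * of_nat ((2 * n) choose j)"
      by (simp add: bin_weight_def x_def N_def)
    also have "(x - N) * ((x - N)\<^sup>2 - 3 * N + 2) * (2 * (x - N)\<^sup>2 - N) = 
      (2*N^2 - 7*N^3 + 7*N^4 - 2*N^5) * 1 + (6 - 31*N + 56*N^2 - 41*N^3 + 10*N^4) * x
     + (42 - 103*N + 81*N^2 - 20*N^3) * (x * (x - 1)) + (54 - 67*N + 20*N^2) * (x * (x - 1) * (x - 2))
     + (20 - 10*N) * (x * (x - 1) * (x - 2) * (x - 3)) + 2 * (x * (x - 1) * (x - 2) * (x - 3) * (x - 4))"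
      by algebra
    finally show "complex_of_real (bin_weight n (int j - int n)) * z ^ j = ((2*N^2 - 7*N^3 + 7*N^4 - 2*N^5) * of_nat (j choose 0) + (6 - 31*N + 56*N^2 - 41*N^3 + 10*N^4) * of_nat (j choose 1)
     + (42 - 103*N + 81*N^2 - 20*N^3) * (of_nat (j choose 2) * 2) + (54 - 67*N + 20*N^2) * (of_nat (j choose 3) * 6)
     + (20 - 10*N) * (of_nat (j choose 4) * 24) + 2 * (of_nat (j choose 5) * 120)) * of_nat ((2 * n) choose j) * z ^ j"
      unfolding falling_factorials_of_nat x_def[symmetric] by (simp add: x_def)
  qed
  also have "\<dots> = (2*N^2 - 7*N^3 + 7*N^4 - 2*N^5) * B 0 + (6 - 31*N + 56*N^2 - 41*N^3 + 10*N^4) * B 1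
     + (42 - 103*N + 81*N^2 - 20*N^3) * (B 2 * 2) + (54 - 67*N + 20*N^2) * (B 3 * 6)
     + (20 - 10*N) * (B 4 * 24) + 2 * (B 5 * 120)"
    unfolding B_def sum_distrib_left sum_distrib_right sum.distrib[symmetric]
    by (intro sum.cong refl) (rule lin)
  also have "B 0 = (1 + z) ^ 5 * y"
    unfolding B_def using assms sum_choose_choose[of 0 "2 * n" z] by (simp add: y_def m_def flip: power_add)
  also have "B 1 = (2 * N) * z * (1 + z) ^ 4 * y"
    unfolding B_def using assms sum_choose_choose[of 1 "2 * n" z]
    by (simp add: y_def m_def N_def mult.assoc flip: power_add)
  also have "B 2 * 2 = (2 * N * (2 * N - 1)) * z ^ 2 * (1 + z) ^ 3 * y"
  proof -
    have "B 2 = of_nat ((2 * n) choose 2) * z ^ 2 * (1 + z) ^ (2 * n - 2)"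
      unfolding B_def by (rule sum_choose_choose) (use assms in simp)
    also have "2 * n - 2 = 3 + m" using assms by (simp add: m_def)
    finally show ?thesis using falling_factorials_of_nat(1)[of "2 * n"] by (simp add: power_add y_def N_def mult_ac)
  qed
  also have "B 3 * 6 = (2 * N * (2 * N - 1) * (2 * N - 2)) * z ^ 3 * (1 + z) ^ 2 * y"
  proof -
    have "B 3 = of_nat ((2 * n) choose 3) * z ^ 3 * (1 + z) ^ (2 * n - 3)"
      unfolding B_def by (rule sum_choose_choose) (use assms in simp)
    also have "2 * n - 3 = 2 + m" using assms by (simp add: m_def)
    finally show ?thesis using falling_factorials_of_nat(2)[of "2 * n"]
      by (simp add: power_add power2_eq_square y_def N_def mult_ac)
  qed
  also have "B 4 * 24 = (2 * N * (2 * N - 1) * (2 * N - 2) * (2 * N - 3)) * z ^ 4 * (1 + z) * y"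
  proof -
    have "B 4 = of_nat ((2 * n) choose 4) * z ^ 4 * (1 + z) ^ (2 * n - 4)"
      unfolding B_def by (rule sum_choose_choose) (use assms in simp)
    also have "2 * n - 4 = 1 + m" using assms by (simp add: m_def)
    finally show ?thesis using falling_factorials_of_nat(3)[of "2 * n"] by (simp add: power_add y_def N_def mult_ac)
  qed
  also have "B 5 * 120 = (2 * N * (2 * N - 1) * (2 * N - 2) * (2 * N - 3) * (2 * N - 4)) * z ^ 5 * y"
  proof -
    have "B 5 = of_nat ((2 * n) choose 5) * z ^ 5 * (1 + z) ^ (2 * n - 5)"
      unfolding B_def by (rule sum_choose_choose) (use assms in simp)
    thus ?thesis using falling_factorials_of_nat(4)[of "2 * n"] by (simp add: y_def m_def N_def mult_ac)
  qed
  also have "(2*N^2 - 7*N^3 + 7*N^4 - 2*N^5) * ((1 + z) ^ 5 * y) + (6 - 31*N + 56*N^2 - 41*N^3 + 10*N^4) * ((2 * N) * z * (1 + z) ^ 4 * y)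
     + (42 - 103*N + 81*N^2 - 20*N^3) * ((2 * N * (2 * N - 1)) * z ^ 2 * (1 + z) ^ 3 * y)
     + (54 - 67*N + 20*N^2) * ((2 * N * (2 * N - 1) * (2 * N - 2)) * z ^ 3 * (1 + z) ^ 2 * y)
     + (20 - 10*N) * ((2 * N * (2 * N - 1) * (2 * N - 2) * (2 * N - 3)) * z ^ 4 * (1 + z) * y)
     + 2 * ((2 * N * (2 * N - 1) * (2 * N - 2) * (2 * N - 3) * (2 * N - 4)) * z ^ 5 * y)
     = (N * (N - 1) * (N - 2) * (2 * N - 1)) * ((z - 1) ^ 3 * y * (6 * z + N * (z - 1)\<^sup>2))"
    by algebra
  finally show ?thesis by (simp add: N_def y_def m_def z_def)
qed

section \<open>Coefficient extraction over a period\<close>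

lemma has_integral_exp_period:
  "((\<lambda>t. exp (of_int a * Complex e t)) has_integral (if a = 0 then of_real (2 * pi) else 0)) {- pi..pi}"
proof (cases "a = 0")
  case True
  have "((\<lambda>t. 1 :: complex) has_integral of_real (pi - - pi) *\<^sub>R 1) {- pi..pi}"
    using has_integral_const_real[of "1 :: complex" "- pi" pi] by simp
  thus ?thesis using True by (simp add: scaleR_conv_of_real)
next
  case False
  define f where "f = (\<lambda>t. exp (of_int a * (of_real e + \<i> * of_real t)) / (\<i> * of_int a))"
  have "((\<lambda>t. exp (of_int a * (of_real e + \<i> * of_real t))) has_integral f pi - f (- pi)) {- pi..pi}"
  proof (rule fundamental_theorem_of_calculus)
    fix t
    have "((\<lambda>w. exp (of_int a * (of_real e + \<i> * w)) / (\<i> * of_int a)) has_field_derivative exp (of_int a * (of_real e + \<i> * of_real t))) (at (of_real t))"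
      using False by (auto intro!: derivative_eq_intros)
    from has_vector_derivative_real_field[OF this]
    show "(f has_vector_derivative exp (of_int a * (of_real e + \<i> * of_real t))) (at t within {- pi..pi})"
      unfolding f_def by simp
  qed simp
  moreover have "f pi = f (- pi)"
  proof -
    have "exp (of_int a * (of_real e + \<i> * of_real pi)) = exp (of_int a * (of_real e + \<i> * of_real (- pi)) + of_int (2 * a) * (of_real pi * \<i>))"
      by (rule arg_cong[where f = exp]) (simp add: algebra_simps)
    also have "\<dots> = exp (of_int a * (of_real e + \<i> * of_real (- pi)))"
    proof -
      have "exp (of_int (2 * a) * (of_real pi * \<i>)) = 1"
        using exp_integer_2pi[of "of_int a"] by (simp add: mult_ac)
      thus ?thesis by (simp only: exp_add) simp
    qed
    finally show ?thesis by (simp add: f_def)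
  qed
  ultimately show ?thesis using False by (simp add: Complex_eq)
qed

text \<open>Orthogonality of exponentials picks out one coefficient. Exponents \<open>k\<close>
  beyond \<open>n\<close> are included: both sides are then 0, so a series may be truncated anywhere
  past \<open>n\<close>.\<close>

lemma has_integral_exp_bin_gen:
  assumes "k \<ge> - int n"
  shows "((\<lambda>t. exp (of_int (- k) * Complex e t) * bin_gen n (Complex e t)) has_integral of_real (2 * pi * bin_weight n k)) {- pi..pi}"
proof -
  have "((\<lambda>t. \<Sum>j\<le>2 * n. of_real (bin_weight n (int j - int n)) * exp (of_int (int j - int n - k) * Complex e t)) has_integral
     (\<Sum>j\<le>2 * n. of_real (bin_weight n (int j - int n)) * (if int j - int n - k = 0 then of_real (2 * pi) else 0))) {- pi..pi}"
    by (intro has_integral_sum has_integral_mult_right has_integral_exp_period) auto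
  also have "(\<lambda>t. \<Sum>j\<le>2 * n. of_real (bin_weight n (int j - int n)) * exp (of_int (int j - int n - k) * Complex e t))
     = (\<lambda>t. exp (of_int (- k) * Complex e t) * bin_gen n (Complex e t))"
  proof
    fix t
    have "exp (of_int (int j - int n - k) * Complex e t) = exp (of_int (- k) * Complex e t) * exp (of_int (int j - int n) * Complex e t)" for j
      unfolding exp_add[symmetric] by (rule arg_cong[where f = exp]) (simp add: algebra_simps)
    thus "(\<Sum>j\<le>2 * n. of_real (bin_weight n (int j - int n)) * exp (of_int (int j - int n - k) * Complex e t))
     = exp (of_int (- k) * Complex e t) * bin_gen n (Complex e t)"
      unfolding bin_gen_def sum_distrib_left by (intro sum.cong refl) (simp only: mult_ac)
  qed
  also have "(\<Sum>j\<le>2 * n. of_real (bin_weight n (int j - int n)) * (if int j - int n - k = 0 then complex_of_real (2 * pi) else 0)) = of_real (2 * pi * bin_weight n k)"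
  proof -
    have "(\<Sum>j\<le>2 * n. of_real (bin_weight n (int j - int n)) * (if int j - int n - k = 0 then complex_of_real (2 * pi) else 0))
      = (\<Sum>j\<le>2 * n. if j = nat (int n + k) then of_real (2 * pi * bin_weight n k) else 0)"
      using assms by (intro sum.cong refl) auto
    also have "\<dots> = (if nat (int n + k) \<le> 2 * n then of_real (2 * pi * bin_weight n k) else 0)"
      by (simp add: sum.delta)
    also have "\<dots> = of_real (2 * pi * bin_weight n k)"
      by (auto simp: bin_weight_def binomial_eq_0)
    finally show ?thesis .
  qed
  finally show ?thesis .
qed

lemma bin_weight_minus:
  assumes "\<bar>k\<bar> \<le> int n"
  shows "bin_weight n (- k) = - bin_weight n k"
proof -
  have "(2 * n) choose nat (int n + k) = (2 * n) choose (2 * n - nat (int n + k))"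
    by (rule binomial_symmetric) (use assms in auto)
  also have "2 * n - nat (int n + k) = nat (int n + - k)" using assms by auto
  finally show ?thesis by (simp add: bin_weight_def)
qed

lemma bin_weight_eq_0: "k > int n \<Longrightarrow> bin_weight n k = 0"
  by (simp add: bin_weight_def binomial_eq_0)

lemma F_eq_sum_bin_weight: "real_of_int (F n) = (\<Sum>k=1..n. real (sigma k) * bin_weight n (int k))"
  unfolding F_def of_int_sum
proof (rule sum.cong[OF refl])
  fix k assume k: "k \<in> {1..n}"
  have "(2 * n) choose (n - k) = (2 * n) choose (2 * n - (n - k))"
    by (rule binomial_symmetric) simp
  also have "2 * n - (n - k) = nat (int n + int k)" using k by auto
  finally show "real_of_int (int k * int (sigma k) * ((int k)\<^sup>2 - 3 * int n + 2) * (2 * (int k)\<^sup>2 - int n) * int ((2 * n) choose (n - k)))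
      = real (sigma k) * bin_weight n (int k)"
    by (simp add: bin_weight_def)
qed

text \<open>Collecting the pairs by their product k produces \<open>sigma k\<close>. A square of
  side \<open>N \<ge> n\<close> contains every pair with product at most \<open>n\<close>, and the
  surplus pairs carry weight 0.\<close>

lemma sum_lambert_square:
  assumes "N \<ge> n"
  shows "(\<Sum>(m, d)\<in>{..<N} \<times> {..<N}. real (Suc d) * bin_weight n (int (Suc m * Suc d))) = real_of_int (F n)"
proof -
  have "real_of_int (F n) = (\<Sum>k=1..n. \<Sum>d | d dvd k. real d * bin_weight n (int k))"
    by (simp add: F_eq_sum_bin_weight sigma_def sum_distrib_right)
  also have "\<dots> = (\<Sum>(k, d)\<in>Sigma {1..n} (\<lambda>k. {d. d dvd k}). real d * bin_weight n (int k))"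
    by (rule sum.Sigma) auto
  also have "\<dots> = (\<Sum>(m, d)\<in>{p \<in> {..<N} \<times> {..<N}. Suc (fst p) * Suc (snd p) \<le> n}. real (Suc d) * bin_weight n (int (Suc m * Suc d)))"
  proof (rule sum.reindex_bij_witness[of _ "\<lambda>(m, d). (Suc m * Suc d, Suc d)" "\<lambda>(k, d). (k div d - 1, d - 1)"])
    fix p assume p: "p \<in> Sigma {1..n} (\<lambda>k. {d. d dvd k})"
    obtain k d where kd: "p = (k, d)" "1 \<le> k" "k \<le> n" "d dvd k" using p by auto
    then obtain c where c: "k = d * c" by auto
    have pos: "d > 0" "c > 0" using kd c by (auto intro: Nat.gr0I)
    have "c \<le> k" by (rule dvd_imp_le) (use kd c in auto)
    moreover have "d \<le> k" by (rule dvd_imp_le) (use kd in auto)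
    ultimately have le: "c \<le> n" "d \<le> n" using kd(3) by linarith+
    have *: "k div d = c" "Suc (c - 1) = c" "Suc (d - 1) = d" using pos by (auto simp: c)
    show "(case case p of (k, d) \<Rightarrow> (k div d - 1, d - 1) of (m, d) \<Rightarrow> (Suc m * Suc d, Suc d)) = p"
      unfolding kd(1) prod.case * by (simp add: c mult.commute)
    show "(case p of (k, d) \<Rightarrow> (k div d - 1, d - 1)) \<in> {p \<in> {..<N} \<times> {..<N}. Suc (fst p) * Suc (snd p) \<le> n}"
      unfolding kd(1) prod.case mem_Collect_eq mem_Times_iff fst_conv snd_conv lessThan_iff *
      using kd(3) assms pos le by (simp add: c mult.commute) linarith
    show "(case case p of (k, d) \<Rightarrow> (k div d - 1, d - 1) of (m, d) \<Rightarrow> real (Suc d) * bin_weight n (int (Suc m * Suc d)))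
       = (case p of (k, d) \<Rightarrow> real d * bin_weight n (int k))"
      unfolding kd(1) prod.case * by (simp add: c mult.commute)
  next
    fix p assume p: "p \<in> {p \<in> {..<N} \<times> {..<N}. Suc (fst p) * Suc (snd p) \<le> n}"
    obtain m d where md: "p = (m, d)" by (cases p)
    show "(case case p of (m, d) \<Rightarrow> (Suc m * Suc d, Suc d) of (k, d) \<Rightarrow> (k div d - 1, d - 1)) = p"
      unfolding md prod.case by (simp del: mult_Suc mult_Suc_right)
    show "(case p of (m, d) \<Rightarrow> (Suc m * Suc d, Suc d)) \<in> Sigma {1..n} (\<lambda>k. {d. d dvd k})"
      using p unfolding md prod.case by (auto simp del: mult_Suc mult_Suc_right)
  qed
  also have "\<dots> = (\<Sum>(m, d)\<in>{..<N} \<times> {..<N}. real (Suc d) * bin_weight n (int (Suc m * Suc d)))"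
    by (rule sum.mono_neutral_left) (auto simp del: mult_Suc mult_Suc_right of_nat_mult intro!: bin_weight_eq_0)
  finally show ?thesis by simp
qed

section \<open>Vanishing sums of the binomial weights\<close>

lemma binomial_central_Suc:
  "(real n + real k + 1) * real ((2 * n) choose (n + Suc k)) = (real n - real k) * real ((2 * n) choose (n + k))"
proof (cases "k \<le> n")
  case True
  have "Suc (n + k) * ((2 * n) choose Suc (n + k)) = (2 * n - (n + k)) * ((2 * n) choose (n + k))"
    by (simp only: binomial_absorption binomial_absorb_comp)
  hence "real (Suc (n + k)) * real ((2 * n) choose Suc (n + k)) = real (2 * n - (n + k)) * real ((2 * n) choose (n + k))"
    by (metis of_nat_mult)
  thus ?thesis using True by (simp add: of_nat_diff algebra_simps)
qed (simp add: binomial_eq_0)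

text \<open>Both sums telescope; the certificates \<open>q\<close> come from Gosper's algorithm.\<close>

lemma sum_telescope_central_binomial:
  fixes q :: "real \<Rightarrow> real"
  assumes "N \<ge> n" "q 0 = 0"
    and "\<And>k. q k * (real n + k) - q (k + 1) * (real n - k) = f k"
  shows "(\<Sum>k<Suc N. f (real k) * real ((2 * n) choose (n + k))) = 0"
proof -
  \<comment> \<open>The factor n + k lets the recurrence rewrite \<open>Z (Suc k)\<close> as a
    polynomial times the same binomial coefficient as in \<open>Z k\<close>. \<open>Z\<close>
    vanishes at 0 through \<open>q 0 = 0\<close> and past \<open>n\<close> through the binomial
    coefficient.\<close>
  define Z where "Z = (\<lambda>k. q (real k) * (real n + real k) * real ((2 * n) choose (n + k)))"
  have "f (real k) * real ((2 * n) choose (n + k)) = Z k - Z (Suc k)" for k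
  proof -
    have "Z (Suc k) = q (real k + 1) * ((real n + real k + 1) * real ((2 * n) choose (n + Suc k)))"
      by (simp add: Z_def algebra_simps)
    also have "\<dots> = q (real k + 1) * (real n - real k) * real ((2 * n) choose (n + k))"
      unfolding binomial_central_Suc by simp
    finally have Zs: "Z (Suc k) = q (real k + 1) * (real n - real k) * real ((2 * n) choose (n + k))" .
    show ?thesis unfolding Zs unfolding Z_def assms(3)[of "real k", symmetric] by (simp add: left_diff_distrib)
  qed
  hence "(\<Sum>k<Suc N. f (real k) * real ((2 * n) choose (n + k))) = (\<Sum>k<Suc N. Z k - Z (Suc k))" by simp
  also have "\<dots> = Z 0 - Z (Suc N)" by (rule sum_lessThan_telescope')
  also have "\<dots> = 0" using assms by (simp add: Z_def binomial_eq_0)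
  finally show ?thesis .
qed

lemma sum_bin_weight_eq_0:
  assumes "N \<ge> n"
  shows "(\<Sum>k<N. bin_weight n (int (Suc k))) = 0"
proof -
  have "(\<Sum>k<Suc N. (real k * ((real k)\<^sup>2 - 3 * real n + 2) * (2 * (real k)\<^sup>2 - real n)) * real ((2 * n) choose (n + k))) = 0"
    by (rule sum_telescope_central_binomial[OF assms, where
      q = "\<lambda>k. k ^ 4 - 2 * k ^ 3 - (3 * real n / 2 - 2) * k\<^sup>2 + (3 * real n / 2 - 1) * k"])
      (simp_all add: field_simps eval_nat_numeral)
  hence "(\<Sum>k<Suc N. bin_weight n (int k)) = 0" by (simp add: bin_weight_def nat_add_distrib del: sum.lessThan_Suc)
  thus ?thesis unfolding sum.lessThan_Suc_shift by (simp add: bin_weight_def)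
qed

lemma sum_k_bin_weight_eq_0:
  assumes "N \<ge> n"
  shows "(\<Sum>k<N. real (Suc k) * bin_weight n (int (Suc k))) = 0"
proof -
  have "(\<Sum>k<Suc N. ((real k)\<^sup>2 * ((real k)\<^sup>2 - 3 * real n + 2) * (2 * (real k)\<^sup>2 - real n)) * real ((2 * n) choose (n + k))) = 0"
    by (rule sum_telescope_central_binomial[OF assms, where
      q = "\<lambda>k. k ^ 5 - 5 / 2 * k ^ 4 - (real n - 2) * k ^ 3 + (3 * real n - 1) / 2 * k\<^sup>2 - real n / 2 * k"])
      (simp_all add: field_simps eval_nat_numeral)
  hence "(\<Sum>k<Suc N. real k * bin_weight n (int k)) = 0"
    by (simp add: bin_weight_def nat_add_distrib power2_eq_square mult.assoc del: sum.lessThan_Suc)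
  thus ?thesis unfolding sum.lessThan_Suc_shift by simp
qed

section \<open>Estimates on the vertical line\<close>

text \<open>Concavity of the sine on [0, pi/2]; the squares dispose of the sign of
  \<open>b\<close>.\<close>

lemma jordan_sin_ge:
  fixes b :: real assumes "\<bar>b\<bar> \<le> pi / 2" shows "(2 * b / pi)\<^sup>2 \<le> (sin b)\<^sup>2"
proof -
  have cv: "convex_on {0..pi / 2} (\<lambda>x. - sin x)"
  proof (rule f''_ge0_imp_convex)
    show "((\<lambda>x. - sin x) has_real_derivative - cos x) (at x)" for x :: real by (auto intro!: derivative_eq_intros)
    show "((\<lambda>x. - cos x) has_real_derivative sin x) (at x)" for x :: real by (auto intro!: derivative_eq_intros)
    show "0 \<le> sin x" if "x \<in> {0..pi / 2}" for x using that by (intro sin_ge_zero) auto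
  qed simp
  have *: "2 * x / pi \<le> sin x" if "0 \<le> x" "x \<le> pi / 2" for x
    using convex_onD_Icc[OF cv, of "2 * x / pi"] that by (simp add: field_simps)
  have "2 * \<bar>b\<bar> / pi \<le> sin \<bar>b\<bar>" using * assms by simp
  hence "(2 * \<bar>b\<bar> / pi)\<^sup>2 \<le> (sin \<bar>b\<bar>)\<^sup>2" by (intro power_mono) auto
  thus ?thesis by (cases "b < 0") (simp_all add: power_mult_distrib power_divide)
qed

lemma norm_sinh_half: "(norm (sinh (Complex a b)))\<^sup>2 = (sinh a)\<^sup>2 + (sin b)\<^sup>2"
  and norm_cosh_half: "(norm (cosh (Complex a b)))\<^sup>2 = (sinh a)\<^sup>2 + (cos b)\<^sup>2"
proof -
  have i: "\<i> * Complex a b = Complex (- b) a" by (simp add: complex_eq_iff)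
  have e: "exp (2 * a) = exp a * exp a" by (simp flip: exp_add)
  have sh: "(sinh a)\<^sup>2 = (exp a - inverse (exp a))\<^sup>2 / 4"
    by (simp add: sinh_field_def exp_minus power_divide)
  have "(norm (sin (\<i> * Complex a b)))\<^sup>2 = (exp (2 * a) + inverse (exp (2 * a)) - 2 * cos (2 * b)) / 4"
    unfolding norm_sin_squared i by simp
  also have "\<dots> = (sinh a)\<^sup>2 + (sin b)\<^sup>2"
    unfolding sh cos_double_sin e by (simp add: power2_eq_square field_simps)
  finally show "(norm (sinh (Complex a b)))\<^sup>2 = (sinh a)\<^sup>2 + (sin b)\<^sup>2"
    by (simp add: sinh_conv_sin norm_mult)
  show "(norm (cosh (Complex a b)))\<^sup>2 = (sinh a)\<^sup>2 + (cos b)\<^sup>2"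
    unfolding cosh_conv_cos norm_cos_squared i sh by simp
qed

text \<open>The coordinates are compared separately, by \<open>e / 2 \<le> sinh (e / 2)\<close> and
  by Jordan's inequality at \<open>t / 2\<close>. The constant pi is attained at s = i pi.\<close>

lemma norm_le_pi_sinh_half:
  assumes "0 \<le> e" "\<bar>t\<bar> \<le> pi"
  shows "norm (Complex e t) \<le> pi * norm (sinh (Complex e t / 2))"
proof -
  have h: "Complex e t / 2 = Complex (e / 2) (t / 2)" by (simp add: complex_eq_iff)
  have "(e / 2)\<^sup>2 \<le> (sinh (e / 2))\<^sup>2" using power_div_fact_le_sinh[of "e / 2" 1] assms by (intro power_mono) auto
  moreover have "(2 * (t / 2) / pi)\<^sup>2 \<le> (sin (t / 2))\<^sup>2" by (rule jordan_sin_ge) (use assms in auto)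
  ultimately have "(e / 2)\<^sup>2 + (t / pi)\<^sup>2 \<le> (norm (sinh (Complex e t / 2)))\<^sup>2"
    unfolding h norm_sinh_half by simp
  hence "pi\<^sup>2 * ((e / 2)\<^sup>2 + (t / pi)\<^sup>2) \<le> pi\<^sup>2 * (norm (sinh (Complex e t / 2)))\<^sup>2" by (intro mult_left_mono) auto
  moreover have "pi\<^sup>2 * ((e / 2)\<^sup>2 + (t / pi)\<^sup>2) = pi\<^sup>2 / 4 * e\<^sup>2 + t\<^sup>2" by (simp add: power_divide distrib_left)
  moreover have "1 * e\<^sup>2 \<le> pi\<^sup>2 / 4 * e\<^sup>2"
  proof (intro mult_right_mono)
    have "2\<^sup>2 \<le> pi\<^sup>2" using pi_gt3 by (intro power_mono) auto
    thus "1 \<le> pi\<^sup>2 / 4" by simp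
  qed simp
  moreover have "(norm (Complex e t))\<^sup>2 = e\<^sup>2 + t\<^sup>2" by (simp add: cmod_power2)
  ultimately have "(norm (Complex e t))\<^sup>2 \<le> (pi * norm (sinh (Complex e t / 2)))\<^sup>2"
    by (simp add: power_mult_distrib)
  thus ?thesis by (rule power2_le_imp_le) simp
qed

section \<open>Gaussian decay of the generating function\<close>

lemma bin_gen_eq_sinh_cosh:
  assumes "n \<ge> 3"
  shows "bin_gen n s = of_real (real n * (real n - 1) * (real n - 2) * (2 * real n - 1)) * 4 ^ n *
    (sinh (s / 2) ^ 3 * cosh (s / 2) ^ (2 * n - 5) * (3 / 2 + of_nat n * (sinh (s / 2))\<^sup>2))"
proof -
  define X where "X = exp (s / 2)"
  define S where "S = sinh (s / 2)"
  define C where "C = cosh (s / 2)"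
  define K where "K = complex_of_real (real n * (real n - 1) * (real n - 2) * (2 * real n - 1))"
  define m where "m = 2 * n - 5"
  have X0: "X \<noteq> 0" by (simp add: X_def)
  have z: "exp s = X\<^sup>2" unfolding X_def exp_of_nat_mult[symmetric] by simp
  have zn: "exp (of_nat n * s) = X ^ (2 * n)" unfolding exp_of_nat_mult z by (simp add: power_mult)
  have i: "exp (- (s / 2)) = inverse X" by (simp add: X_def exp_minus)
  have S: "exp s - 1 = 2 * X * S" unfolding z S_def sinh_conv_exp i X_def[symmetric] using X0 by (simp add: field_simps power2_eq_square)
  have C: "1 + exp s = 2 * X * C" unfolding z C_def cosh_conv_exp i X_def[symmetric] using X0 by (simp add: field_simps power2_eq_square)
  have "bin_gen n s * X ^ (2 * n) = K * ((2 * X * S) ^ 3 * (2 * X * C) ^ m * (6 * X\<^sup>2 + of_nat n * (2 * X * S)\<^sup>2))"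
    using bin_gen_eq[OF assms, of s] unfolding S C zn K_def m_def unfolding z .
  also have "\<dots> = K * (2 ^ (m + 5) * (S ^ 3 * C ^ m * (3 / 2 + of_nat n * S\<^sup>2))) * X ^ (m + 5)"
    by (simp add: power_mult_distrib power_add field_simps eval_nat_numeral)
  also have "m + 5 = 2 * n" using assms by (simp add: m_def)
  finally show ?thesis using X0
    by (simp add: K_def S_def C_def m_def power_mult mult.assoc)
qed

lemma power_exp_le_fact:
  fixes x :: real assumes "x \<ge> 0" shows "x ^ k * exp (- x) \<le> fact k"
proof -
  have "(\<Sum>n\<in>{k}. x ^ n /\<^sub>R fact n) \<le> exp x"
    unfolding exp_def by (rule sum_le_suminf[OF summable_exp_generic]) (use assms in auto)
  hence "x ^ k \<le> fact k * exp x" by (simp add: field_simps)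
  thus ?thesis by (simp add: exp_minus field_simps)
qed

text \<open>From x^k exp(- x) \<le> k! at x = (n - 5/2) w^2, where the shift 5/2 stems from the
  exponent 2n - 5 of cosh. Replacing n - 5/2 by n costs at most (1 + 1/3000)^12 < 101/100; the
  largest power met later is w^24.\<close>

lemma power_gauss_le:
  fixes w :: real
  assumes "n \<ge> 10000" "k \<le> 12"
  shows "w ^ (2 * k) * exp (- (real n - 5 / 2) * w\<^sup>2) \<le> 101 / 100 * fact k / real n ^ k"
proof -
  define v where "v = real n - 5 / 2"
  have v: "v > 0" using assms by (simp add: v_def)
  have "(v * w\<^sup>2) ^ k * exp (- (v * w\<^sup>2)) \<le> fact k" using v by (intro power_exp_le_fact) auto
  hence "w ^ (2 * k) * exp (- v * w\<^sup>2) \<le> fact k / v ^ k"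
    unfolding power_mult[of w 2 k] using v by (simp add: power_mult_distrib field_simps)
  also have "\<dots> \<le> 101 / 100 * fact k / real n ^ k"
  proof -
    have nv: "real n \<le> (1 + 1 / 3000) * v" using assms by (simp add: v_def)
    hence "real n ^ k \<le> ((1 + 1 / 3000) * v) ^ k" by (intro power_mono) auto
    also have "\<dots> = (1 + 1 / 3000) ^ k * v ^ k" by (rule power_mult_distrib)
    also have "\<dots> \<le> (1 + 1 / 3000) ^ 12 * v ^ k" using v assms by (intro mult_right_mono power_increasing) auto
    also have "\<dots> \<le> 101 / 100 * v ^ k" using v by (intro mult_right_mono) (auto simp: eval_nat_numeral)
    finally have "fact k * real n ^ k \<le> fact k * (101 / 100 * v ^ k)" by (intro mult_left_mono) auto
    thus ?thesis using v assms by (simp add: field_simps)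
  qed
  finally show ?thesis by (simp add: v_def)
qed

text \<open>The squared norms of sinh and cosh at s/2 add up to 1 + 2 (sinh a)^2, so by 1 + x \<le>
  exp x the power of cosh is at most a Gaussian in \<open>w\<close> times exp((2n - 5) (sinh a)^2).
  The abscissa is tuned to this: for a = 1/sqrt n the extra factor is close to e^2 and below
  8.\<close>

lemma norm_bin_gen_le:
  fixes e t :: real
  assumes n: "n \<ge> 10000" and e: "e = 2 / sqrt (real n)"
  defines "w \<equiv> norm (sinh (Complex e t / 2))"
  shows "norm (bin_gen n (Complex e t)) \<le> 16 * real n ^ 4 * 4 ^ n * (w ^ 3 * (3 / 2 + real n * w\<^sup>2) * exp (- (real n - 5 / 2) * w\<^sup>2))"
proof -
  define s where "s = Complex e t"
  define y where "y = norm (cosh (s / 2))"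
  define K where "K = real n * (real n - 1) * (real n - 2) * (2 * real n - 1)"
  have h: "s / 2 = Complex (e / 2) (t / 2)" by (simp add: s_def complex_eq_iff)
  define a where "a = e / 2"
  have a: "a = 1 / sqrt (real n)" "a > 0" using n by (simp_all add: a_def e)
  have a2: "a\<^sup>2 = 1 / real n" by (simp add: a power_divide)
  have a100: "a \<le> 1 / 100"
  proof -
    have "100 \<le> sqrt (real n)" using n by (intro real_le_rsqrt) auto
    thus ?thesis unfolding a using frac_le[of 1 1 100 "sqrt (real n)"] by simp
  qed
  have sinh2: "(sinh a)\<^sup>2 \<le> 102 / 100 / real n"
  proof -
    have "exp a \<le> 1 + a + a\<^sup>2" using a a100 by (intro exp_bound) auto
    moreover have "1 + (- a) \<le> exp (- a)" by (rule exp_ge_add_one_self)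
    moreover have "a\<^sup>2 \<le> a * (1 / 100)" unfolding power2_eq_square using a a100 by (intro mult_left_mono) auto
    ultimately have "sinh a \<le> 201 / 200 * a" by (simp add: sinh_field_def)
    hence "(sinh a)\<^sup>2 \<le> (201 / 200 * a)\<^sup>2" using a by (intro power_mono) auto
    also have "\<dots> \<le> 102 / 100 * a\<^sup>2" by (simp add: power_mult_distrib power_divide)
    finally show ?thesis unfolding a2 by simp
  qed
  have w2: "w\<^sup>2 = (sinh a)\<^sup>2 + (sin (t / 2))\<^sup>2"
    unfolding w_def s_def[symmetric] h norm_sinh_half a_def ..
  have y2: "y\<^sup>2 = 1 + 2 * (sinh a)\<^sup>2 - w\<^sup>2"
    unfolding y_def h norm_cosh_half w2 a_def cos_squared_eq by simp
  have "y\<^sup>2 \<le> exp (2 * (sinh a)\<^sup>2 - w\<^sup>2)"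
    unfolding y2 using exp_ge_add_one_self[of "2 * (sinh a)\<^sup>2 - w\<^sup>2"] by linarith
  also have "\<dots> = (exp ((2 * (sinh a)\<^sup>2 - w\<^sup>2) / 2))\<^sup>2" by (simp flip: exp_of_nat_mult)
  finally have "y \<le> exp ((2 * (sinh a)\<^sup>2 - w\<^sup>2) / 2)" by (rule power2_le_imp_le) simp
  hence "y ^ (2 * n - 5) \<le> exp ((2 * (sinh a)\<^sup>2 - w\<^sup>2) / 2) ^ (2 * n - 5)"
    by (intro power_mono) (auto simp: y_def)
  also have "\<dots> = exp (real (2 * n - 5) * (sinh a)\<^sup>2) * exp (- (real n - 5 / 2) * w\<^sup>2)"
    unfolding exp_of_nat_mult[symmetric] exp_add[symmetric]
    using n by (intro arg_cong[where f = exp]) (simp add: of_nat_diff field_simps)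
  also have "\<dots> \<le> 8 * exp (- (real n - 5 / 2) * w\<^sup>2)"
  proof (intro mult_right_mono)
    have "real (2 * n - 5) * (sinh a)\<^sup>2 \<le> (2 * real n) * (102 / 100 / real n)"
      by (intro mult_mono sinh2) auto
    also have "\<dots> \<le> 2 + 1 / 25" using n by simp
    finally have "exp (real (2 * n - 5) * (sinh a)\<^sup>2) \<le> exp (2 + 1 / 25)" by simp
    also have "\<dots> = (exp 1)\<^sup>2 * exp (1 / 25)" 
      using exp_add[of 2 "1 / 25 :: real"] exp_of_nat_mult[of 2 "1 :: real"] by (simp only: of_nat_numeral mult_1_right)
    also have "\<dots> \<le> (272 / 100)\<^sup>2 * (21 / 20)"
      using e_less_272 exp_small_le[of "1 / 25"] by (intro mult_mono power_mono) auto
    also have "\<dots> \<le> 8" by (simp add: power2_eq_square)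
    finally show "exp (real (2 * n - 5) * (sinh a)\<^sup>2) \<le> 8" .
  qed simp
  finally have y: "y ^ (2 * n - 5) \<le> 8 * exp (- (real n - 5 / 2) * w\<^sup>2)" .
  have K: "0 \<le> K" "K \<le> 2 * real n ^ 4"
  proof -
    have "K \<le> real n * real n * real n * (2 * real n)" unfolding K_def using n by (intro mult_mono) auto
    thus "K \<le> 2 * real n ^ 4" by (simp add: eval_nat_numeral)
    show "0 \<le> K" unfolding K_def using n by simp
  qed
  have br: "norm (3 / 2 + of_nat n * (sinh (s / 2))\<^sup>2) \<le> 3 / 2 + real n * w\<^sup>2"
    using norm_triangle_ineq[of "3 / 2" "of_nat n * (sinh (s / 2))\<^sup>2"]
    by (simp add: norm_mult norm_power w_def s_def)
  have "bin_gen n s = of_real K * 4 ^ n * (sinh (s / 2) ^ 3 * cosh (s / 2) ^ (2 * n - 5) * (3 / 2 + of_nat n * (sinh (s / 2))\<^sup>2))"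
    unfolding K_def by (rule bin_gen_eq_sinh_cosh) (use n in simp)
  hence "norm (bin_gen n s) = K * 4 ^ n * (w ^ 3 * y ^ (2 * n - 5) * norm (3 / 2 + of_nat n * (sinh (s / 2))\<^sup>2))"
    using K by (simp add: norm_mult norm_power w_def s_def y_def)
  also have "\<dots> \<le> 2 * real n ^ 4 * 4 ^ n * (w ^ 3 * (8 * exp (- (real n - 5 / 2) * w\<^sup>2)) * (3 / 2 + real n * w\<^sup>2))"
    using K by (intro mult_mono y br) (auto simp: w_def y_def)
  finally show ?thesis by (simp add: s_def mult_ac)
qed

text \<open>In squared form the induction step reduces to 4n(n + 1) \<le> (2n + 1)^2. Dividing an
  error of size 4^n by the central binomial coefficient by means of this bound is what produces the
  factor sqrt n.\<close>

lemma central_binomial_ge: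
  assumes "n \<ge> 1"
  shows "4 ^ n \<le> 2 * sqrt (real n) * real ((2 * n) choose n)"
proof -
  have "(4 ^ n)\<^sup>2 \<le> 4 * real n * (real ((2 * n) choose n))\<^sup>2"
    using assms
  proof (induction n rule: nat_induct_at_least)
    case base
    show ?case by (simp add: numeral_2_eq_2)
  next
    case (Suc n)
    define b where "b = real ((2 * n) choose n)"
    define c where "c = real ((2 * Suc n) choose Suc n)"
    have "Suc n * ((2 * Suc n) choose Suc n) = 2 * (2 * n + 1) * ((2 * n) choose n)"
    proof -
      have "Suc n * ((2 * Suc n) choose Suc n) = (2 * Suc n) * ((2 * n + 1) choose n)"
        using binomial_absorption[of n "2 * Suc n"] by simp
      moreover have "Suc n * ((2 * n + 1) choose n) = (2 * n + 1) * ((2 * n) choose n)"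
        using binomial_absorb_comp[of "2 * n + 1" n] by simp
      ultimately show ?thesis by (simp add: algebra_simps)
    qed
    hence "real (Suc n * ((2 * Suc n) choose Suc n)) = real (2 * (2 * n + 1) * ((2 * n) choose n))" by (rule arg_cong)
    hence rec: "(real n + 1) * c = 2 * (2 * real n + 1) * b" by (simp add: b_def c_def algebra_simps)
    have n1: "real n \<ge> 1" using Suc by simp
    have "real n * (real n + 1) * (16 * (4 ^ n)\<^sup>2) \<le> real n * (real n + 1) * (16 * (4 * real n * b\<^sup>2))"
      using Suc.IH by (intro mult_left_mono) (auto simp: b_def)
    also have "\<dots> \<le> 4 * real n * (4 * (2 * real n + 1)\<^sup>2 * b\<^sup>2)"
    proof -
      have "4 * (real n * (real n + 1)) * b\<^sup>2 \<le> (2 * real n + 1)\<^sup>2 * b\<^sup>2"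
        by (intro mult_right_mono) (auto simp: power2_eq_square algebra_simps)
      from mult_left_mono[OF this, of "16 * real n"] show ?thesis by (simp add: algebra_simps)
    qed
    also have "4 * (2 * real n + 1)\<^sup>2 * b\<^sup>2 = ((real n + 1) * c)\<^sup>2" unfolding rec by (simp add: power2_eq_square algebra_simps)
    also have "4 * real n * ((real n + 1) * c)\<^sup>2 = real n * (real n + 1) * (4 * (real n + 1) * c\<^sup>2)"
      by (simp add: power2_eq_square)
    finally have "16 * (4 ^ n)\<^sup>2 \<le> 4 * (real n + 1) * c\<^sup>2" using n1 by (simp add: mult_le_cancel_left)
    thus ?case by (simp add: c_def power_mult_distrib add.commute)
  qed
  also have "\<dots> = (2 * sqrt (real n) * real ((2 * n) choose n))\<^sup>2" by (simp add: power_mult_distrib)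
  finally show ?thesis by (rule power2_le_imp_le) simp
qed

section \<open>The remainder after removal of the poles\<close>

text \<open>The constant 5/24 is 1/4 - 1/24: the explicit 1/4 of \<open>linear_series\<close> is
  subtracted from the 1/24 of the transformation law.\<close>

definition trig_part :: "complex \<Rightarrow> complex" where
  "trig_part s = of_real (pi\<^sup>2 / 6) * (191 / 2016 - 47 / 3780 * cosh s + 31 / 30240 * cosh (2 * s))
       + 41 / 720 * sinh s - 11 / 1440 * sinh (2 * s) - 5 / 24"

text \<open>Closed form of the sum of all \<open>linear_term k s\<close>; the expression in brackets
  is the geometric sum of exp(- k s) over k \<ge> 1.\<close>

definition linear_series :: "complex \<Rightarrow> complex" where
  "linear_series s = of_real (pi\<^sup>2 / 6) * csch_half_sq s - (cosh (s / 2) / (2 * sinh (s / 2)) - 1 / 2) / 2"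

definition linear_term :: "nat \<Rightarrow> complex \<Rightarrow> complex" where
  "linear_term k s = of_real (pi\<^sup>2 / 6 * real (Suc k) - 1 / 2) * exp (- (of_nat (Suc k) * s))"

lemma coth_half_conv_exp:
  fixes s :: complex
  assumes "exp (- s) \<noteq> 1"
  shows "cosh (s / 2) / (2 * sinh (s / 2)) - 1 / 2 = exp (- s) / (1 - exp (- s))"
proof -
  define X where "X = exp (s / 2)"
  define q where "q = exp (- s)"
  have X0: "X \<noteq> 0" by (simp add: X_def)
  have "exp (- (s / 2)) = X * q"
    unfolding X_def q_def exp_add[symmetric] by (rule arg_cong[where f = exp]) simp
  hence cs: "cosh (s / 2) = X * (1 + q) / 2" "sinh (s / 2) = X * (1 - q) / 2"
    by (simp_all add: cosh_conv_exp sinh_conv_exp X_def[symmetric] algebra_simps)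
  have h: "cosh (s / 2) / (2 * sinh (s / 2)) = (1 + q) / (2 * (1 - q))" unfolding cs using X0 by simp
  have "1 - q \<noteq> 0" using assms by (simp add: q_def)
  thus ?thesis unfolding q_def[symmetric] h by (simp add: field_simps)
qed

lemma linear_term_sums:
  assumes "Re s > 0"
  shows "(\<lambda>k. linear_term k s) sums linear_series s"
proof -
  define q where "q = exp (- s)"
  have q: "norm q < 1" using assms by (simp add: q_def)
  hence q1: "q \<noteq> 1" by auto
  have e: "exp (- (of_nat (Suc k) * s)) = q * q ^ k" for k
    using exp_of_nat_mult[of "Suc k" "- s"] by (simp only: q_def power_Suc mult_minus_right)
  have "(\<lambda>k. of_real (pi\<^sup>2 / 6) * lambert s (0, k) - 1 / 2 * (q * q ^ k)) sums
     (of_real (pi\<^sup>2 / 6) * csch_half_sq (of_nat (Suc 0) * s) - 1 / 2 * (q * (1 / (1 - q))))"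
    by (intro sums_diff sums_mult lambert_row geometric_sums assms q)
  moreover have "of_real (pi\<^sup>2 / 6) * lambert s (0, k) - 1 / 2 * (q * q ^ k) = linear_term k s" for k
    by (simp only: linear_term_def lambert_def prod.case One_nat_def[symmetric] mult_1 e) (simp add: algebra_simps)
  moreover have "of_real (pi\<^sup>2 / 6) * csch_half_sq (of_nat (Suc 0) * s) - 1 / 2 * (q * (1 / (1 - q))) = linear_series s"
    using coth_half_conv_exp[of s] q1 by (simp add: linear_series_def q_def)
  ultimately show ?thesis by simp
qed

lemma linear_term_uniform:
  assumes "e > 0" "\<delta> > 0"
  shows "\<exists>N\<ge>M. \<forall>s. Re s = e \<longrightarrow> norm (linear_series s - (\<Sum>k<N. linear_term k s)) \<le> \<delta>"
proof -
  define B where "B = (\<lambda>k. (pi\<^sup>2 / 6 + 1 / 2) * norm (lambert (of_real e) (0, k)))"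
  have "summable (\<lambda>k. norm (lambert (of_real e) (0, k)))"
  proof -
    define x where "x = exp (- e)"
    have x: "norm x < 1" using assms by (simp add: x_def)
    have "norm (lambert (of_real e) (0, k)) = x * (of_nat (Suc k) * x ^ k)" for k
    proof -
      have "exp (real (Suc 0 * Suc k) * - e) = x ^ Suc k" unfolding x_def exp_of_nat_mult[symmetric] by simp
      thus ?thesis unfolding norm_lambert Re_complex_of_real by (simp only: power_Suc) (simp add: mult_ac)
    qed
    thus ?thesis using sums_summable[OF sums_mult[OF geometric_deriv_sums[OF x], of x]] by simp
  qed
  hence "summable B" unfolding B_def by (intro summable_mult)
  moreover have "norm (linear_term k s) \<le> B k" if "s \<in> {s. Re s = e}" for k s
  proof -
    have "\<bar>pi\<^sup>2 / 6 * real (Suc k) - 1 / 2\<bar> \<le> (pi\<^sup>2 / 6 + 1 / 2) * real (Suc k)"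
    proof -
      have "1 / 2 \<le> 1 / 2 * real (Suc k)" by simp
      moreover have "0 \<le> pi\<^sup>2 / 6 * real (Suc k)" by simp
      ultimately show ?thesis unfolding distrib_right by linarith
    qed
    hence "\<bar>pi\<^sup>2 / 6 * real (Suc k) - 1 / 2\<bar> * exp (real (Suc k) * - e) \<le> (pi\<^sup>2 / 6 + 1 / 2) * real (Suc k) * exp (real (Suc k) * - e)"
      by (intro mult_right_mono) auto
    moreover have "norm (linear_term k s) = \<bar>pi\<^sup>2 / 6 * real (Suc k) - 1 / 2\<bar> * exp (real (Suc k) * - e)"
      using that unfolding linear_term_def norm_mult norm_of_real norm_exp_eq_Re
      by (simp only: mem_Collect_eq uminus_complex.sel times_complex.sel complex_Re_of_nat complex_Im_of_nat mult_zero_left diff_zero mult_minus_right)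
    ultimately show ?thesis unfolding B_def norm_lambert by (simp only: Re_complex_of_real mult_1 One_nat_def[symmetric] mult.assoc)
  qed
  ultimately have "uniform_limit {s. Re s = e} (\<lambda>N s. \<Sum>k<N. linear_term k s) (\<lambda>s. suminf (\<lambda>k. linear_term k s)) sequentially"
    by (intro Weierstrass_m_test) auto
  from uniform_limitD[OF this assms(2)] have "\<forall>\<^sub>F N in sequentially. \<forall>s\<in>{s. Re s = e}. dist (\<Sum>k<N. linear_term k s) (\<Sum>k. linear_term k s) < \<delta>" .
  then obtain N0 where N0: "\<And>N s. N \<ge> N0 \<Longrightarrow> Re s = e \<Longrightarrow> dist (\<Sum>k<N. linear_term k s) (\<Sum>k. linear_term k s) < \<delta>"
    unfolding eventually_sequentially by auto
  have "norm (linear_series s - (\<Sum>k<max M N0. linear_term k s)) \<le> \<delta>" if s: "Re s = e" for s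
    using N0[of "max M N0" s] s linear_term_sums[of s] assms(1)
    by (simp add: sums_iff dist_norm norm_minus_commute less_imp_le)
  thus ?thesis by (intro exI[of _ "max M N0"]) auto
qed

text \<open>Two errors meet the decay of \<open>bin_gen\<close>: w^5 from the trigonometric
  approximation and n^5 w^18 from the transformed series. Against the Gaussian each power of w is
  worth n^(-1/2), so the first yields a constant times 4^n and the second is smaller by
  n^(-3/2).\<close>

lemma integrand_bound:
  assumes n: "n \<ge> 10000" and e: "e = 2 / sqrt (real n)" and t: "\<bar>t\<bar> \<le> pi"
  defines "s \<equiv> Complex e t"
  shows "norm (((\<Sum>m. csch_half_sq (of_nat (Suc m) * s)) - linear_series s - trig_part s) * bin_gen n s) \<le> 15700 * 4 ^ n"
proof -
  define r where "r = sqrt (real n)"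
  define w where "w = norm (sinh (s / 2))"
  define E where "E = exp (- (real n - 5 / 2) * w\<^sup>2)"
  have r: "r \<ge> 100" unfolding r_def using n by (intro real_le_rsqrt) auto
  have r2: "r\<^sup>2 = real n" by (simp add: r_def)
  have er: "e = 2 / r" by (simp add: e r_def)
  have e0: "e > 0" "e \<le> 1 / 50" unfolding er using r frac_le[of 2 2 100 r] by simp_all
  have rn: "r > 0" "real n > 0" using r n by auto
  have w0: "w \<ge> 0" and E0: "E \<ge> 0" by (simp_all add: w_def E_def)
  have s: "Re s = e" "Im s = t" by (simp_all add: s_def)
  have s0: "s \<noteq> 0" using e0 s by auto
  have spi: "norm s \<le> pi * w" unfolding s_def w_def by (rule norm_le_pi_sinh_half) (use e0 t in auto)
  have ns: "norm s \<le> 16 / 5"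
  proof -
    have "norm s \<le> \<bar>Re s\<bar> + \<bar>Im s\<bar>" by (rule cmod_le)
    thus ?thesis using s e0 t pi_approx by simp
  qed
  have trig': "norm (of_real (pi\<^sup>2 / 6) * (1 / s\<^sup>2 - csch_half_sq s) + (cosh (s / 2) / (2 * sinh (s / 2)) - 1 / s) / 2
     - (trig_part s + 5 / 24)) \<le> norm s ^ 5 / 50"
    using trig_approximation[of s] ns s e0 spi s0 by (simp add: trig_part_def w_def)
  obtain R where R: "(\<lambda>k. 1 / (sinh (2 * of_real pi ^ 2 * of_nat (Suc k) / s))\<^sup>2) sums R"
    "(\<lambda>m. csch_half_sq (of_nat (Suc m) * s)) sums (of_real pi ^ 2 / (6 * s\<^sup>2) - 1 / (2 * s) + 1 / 24 - of_real pi ^ 2 / s\<^sup>2 * R)"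
    using csch_half_sq_series_transformation[of s] s e0 by auto
  define P where "P = of_real pi ^ 2 / s\<^sup>2 * R"
  have "norm P \<le> 24 * (w\<^sup>2) ^ 9 / Re s ^ 10"
  proof -
    have "(norm s)\<^sup>2 \<le> (pi * w)\<^sup>2" using spi by (intro power_mono) auto
    thus ?thesis unfolding P_def using s e0 R(1) by (intro norm_csch_half_sq_series_remainder) (auto simp: power_mult_distrib)
  qed
  \<comment> \<open>Here \<open>Re s\<close> is 2/sqrt n, so its tenth power is 1024 / n^5.\<close>
  also have "\<dots> = 24 / 1024 * real n ^ 5 * w ^ 18"
  proof -
    have "r ^ 10 = real n ^ 5" unfolding r2[symmetric] by (simp flip: power_mult)
    moreover have "(w\<^sup>2) ^ 9 = w ^ 18" by (simp flip: power_mult)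
    ultimately show ?thesis using r unfolding s(1) er by (simp add: power_divide)
  qed
  finally have P: "norm P \<le> 24 / 1024 * real n ^ 5 * w ^ 18" .
  have s5: "norm s ^ 5 / 50 \<le> 307 / 50 * w ^ 5"
  proof -
    have "norm s ^ 5 \<le> (pi * w) ^ 5" using spi by (intro power_mono) auto
    also have "\<dots> = pi ^ 5 * w ^ 5" by (rule power_mult_distrib)
    also have "\<dots> \<le> 307 * w ^ 5"
    proof (intro mult_right_mono)
      have "pi ^ 5 \<le> 3.1416 ^ 5" using pi_approx by (intro power_mono) auto
      thus "pi ^ 5 \<le> 307" by (simp add: eval_nat_numeral)
    qed (use w0 in simp)
    finally show ?thesis by simp
  qed
  define Q where "Q = of_real (pi\<^sup>2 / 6) * (1 / s\<^sup>2 - csch_half_sq s) + (cosh (s / 2) / (2 * sinh (s / 2)) - 1 / s) / 2 - (trig_part s + 5 / 24)"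
  have "(\<Sum>m. csch_half_sq (of_nat (Suc m) * s)) - linear_series s - trig_part s = Q - P"
    using R(2) by (simp add: sums_iff Q_def P_def linear_series_def algebra_simps diff_divide_distrib)
  hence D: "norm ((\<Sum>m. csch_half_sq (of_nat (Suc m) * s)) - linear_series s - trig_part s) \<le> 307 / 50 * w ^ 5 + 24 / 1024 * real n ^ 5 * w ^ 18"
    using norm_triangle_ineq4[of Q P] trig' s5 P unfolding Q_def[symmetric] by simp
  have g: "real n ^ k * (w ^ (2 * k) * E) \<le> 101 / 100 * fact k" if "k \<le> 12" for k
    using power_gauss_le[OF n that, of w] n unfolding E_def by (simp add: field_simps)
  have f1: "real n ^ 4 * (w ^ 8 * (3 / 2 + real n * w\<^sup>2) * E) \<le> 1576 / 10"
  proof -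
    have "real n ^ 4 * (w ^ 8 * (3 / 2 + real n * w\<^sup>2) * E) = 3 / 2 * (real n ^ 4 * (w ^ (2 * 4) * E)) + real n ^ 5 * (w ^ (2 * 5) * E)"
      by (simp add: field_simps eval_nat_numeral)
    also have "\<dots> \<le> 3 / 2 * (101 / 100 * fact 4) + 101 / 100 * fact 5"
      by (intro add_mono mult_left_mono g) auto
    also have "\<dots> \<le> 1576 / 10" by (simp add: fact_numeral)
    finally show ?thesis .
  qed
  \<comment> \<open>The total power of \<open>w\<close> is odd while \<open>power_gauss_le\<close>
    treats even powers; one factor \<open>w\<close> is traded through 2 sqrt(n) w \<le> 1 + n
    w^2.\<close>
  have f2: "real n ^ 9 * (w * w ^ 20 * (3 / 2 + real n * w\<^sup>2) * E) \<le> 300"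
  proof -
    have "w * (2 * r) \<le> 1 + real n * w\<^sup>2"
      using zero_le_power2[of "r * w - 1"] unfolding r2[symmetric] by (simp add: power2_eq_square algebra_simps)
    hence wle: "w \<le> (1 + real n * w\<^sup>2) / (2 * r)" using r by (simp add: field_simps)
    have "real n ^ 9 * (w * w ^ 20 * (3 / 2 + real n * w\<^sup>2) * E) \<le> real n ^ 9 * ((1 + real n * w\<^sup>2) / (2 * r) * w ^ 20 * (3 / 2 + real n * w\<^sup>2) * E)"
      using w0 E0 by (intro mult_left_mono mult_right_mono wle) auto
    also have "\<dots> = (3 / 2 * (real n ^ 10 * (w ^ (2 * 10) * E)) + 5 / 2 * (real n ^ 11 * (w ^ (2 * 11) * E)) + real n ^ 12 * (w ^ (2 * 12) * E)) / (2 * r * real n)"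
    proof -
      define a where "a = real n ^ 9 * (w ^ 20 * E)"
      have p: "real n ^ 10 = real n * real n ^ 9" "real n ^ 11 = (real n)\<^sup>2 * real n ^ 9" "real n ^ 12 = real n ^ 3 * real n ^ 9"
        "w ^ (2 * 10) = w ^ 20" "w ^ (2 * 11) = w\<^sup>2 * w ^ 20" "w ^ (2 * 12) = w ^ 4 * w ^ 20" by (simp_all flip: power_Suc power_add)
      have a: "real n ^ 10 * (w ^ (2 * 10) * E) = real n * a" "real n ^ 11 * (w ^ (2 * 11) * E) = (real n)\<^sup>2 * w\<^sup>2 * a"
        "real n ^ 12 * (w ^ (2 * 12) * E) = real n ^ 3 * w ^ 4 * a" unfolding p a_def by (simp_all only: mult_ac)
      have "real n ^ 9 * ((1 + real n * w\<^sup>2) / (2 * r) * w ^ 20 * (3 / 2 + real n * w\<^sup>2) * E)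
         = (1 + real n * w\<^sup>2) * (3 / 2 + real n * w\<^sup>2) * a / (2 * r)" by (simp add: a_def)
      also have "\<dots> = (3 / 2 * (real n * a) + 5 / 2 * ((real n)\<^sup>2 * w\<^sup>2 * a) + real n ^ 3 * w ^ 4 * a) / (2 * r * real n)"
        using rn by (simp add: field_simps power2_eq_square power3_eq_cube power4_eq_xxxx)
      finally show ?thesis unfolding a .
    qed
    also have "\<dots> \<le> (3 / 2 * (101 / 100 * fact 10) + 5 / 2 * (101 / 100 * fact 11) + 101 / 100 * fact 12) / (2 * 100 * 10000)"
    proof (rule frac_le)
      show "3 / 2 * (real n ^ 10 * (w ^ (2 * 10) * E)) + 5 / 2 * (real n ^ 11 * (w ^ (2 * 11) * E)) + real n ^ 12 * (w ^ (2 * 12) * E)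
        \<le> 3 / 2 * (101 / 100 * fact 10) + 5 / 2 * (101 / 100 * fact 11) + 101 / 100 * fact 12"
        by (intro add_mono mult_left_mono g) auto
      show "2 * 100 * 10000 \<le> 2 * r * real n" using r n by (intro mult_mono) auto
    qed auto
    also have "\<dots> \<le> 300" by (simp add: fact_numeral)
    finally show ?thesis .
  qed
  have "norm (((\<Sum>m. csch_half_sq (of_nat (Suc m) * s)) - linear_series s - trig_part s) * bin_gen n s)
     \<le> (307 / 50 * w ^ 5 + 24 / 1024 * real n ^ 5 * w ^ 18) * (16 * real n ^ 4 * 4 ^ n * (w ^ 3 * (3 / 2 + real n * w\<^sup>2) * E))"
    unfolding norm_mult using norm_bin_gen_le[OF n e, of t] D w0 
    by (intro mult_mono) (auto simp: w_def E_def s_def)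
  \<comment> \<open>The coefficients are 2456/25 = 16 * 307/50 and 3/8 = 16 * 24/1024; with the two
    bounds just proved the total is about 15595.\<close>
  also have "\<dots> = 4 ^ n * (2456 / 25 * (real n ^ 4 * (w ^ 8 * (3 / 2 + real n * w\<^sup>2) * E)) + 3 / 8 * (real n ^ 9 * (w * w ^ 20 * (3 / 2 + real n * w\<^sup>2) * E)))"
  proof -
    have p: "w ^ 8 = w ^ 5 * w ^ 3" "w * w ^ 20 = w ^ 18 * w ^ 3" "real n ^ 9 = real n ^ 5 * real n ^ 4"
      by (simp_all flip: power_add power_Suc)
    have "(307 / 50 * a + 24 / 1024 * N5 * b) * (16 * N4 * Z * (c * B * E)) = 
        Z * (2456 / 25 * (N4 * (a * c * B * E)) + 3 / 8 * (N5 * N4 * (b * c * B * E)))" for a b c B N4 N5 Z :: real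
      by (simp add: algebra_simps)
    thus ?thesis unfolding p .
  qed
  also have "\<dots> \<le> 4 ^ n * (2456 / 25 * (1576 / 10) + 3 / 8 * 300)"
    by (intro mult_left_mono add_mono f1 f2) auto
  also have "\<dots> \<le> 15700 * 4 ^ n" by simp
  finally show ?thesis .
qed

section \<open>Fourier coefficients and the main estimate\<close>

text \<open>The weights are odd in k, so the even part of \<open>trig_part\<close> integrates to 0
  and only the two sinh coefficients reach the main term; the cosh terms serve the pointwise
  estimate of the integrand.\<close>

lemma trig_part_integral:
  assumes "n \<ge> 2"
  shows "((\<lambda>t. trig_part (Complex e t) * bin_gen n (Complex e t)) has_integral
     of_real (2 * pi * (- 41 / 720 * bin_weight n 1 + 11 / 1440 * bin_weight n 2))) {- pi..pi}"
proof -
  define P where "P = complex_of_real (pi\<^sup>2 / 6)"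
  define f where "f = (\<lambda>k t. exp (of_int (- k) * Complex e t) * bin_gen n (Complex e t))"
  define c0 where "c0 = P * (191 / 2016) - 5 / 24"
  define c1 where "c1 = - P * (47 / 7560) - 41 / 1440"
  define c1' where "c1' = - P * (47 / 7560) + 41 / 1440"
  define c2 where "c2 = P * (31 / 60480) + 11 / 2880"
  define c2' where "c2' = P * (31 / 60480) - 11 / 2880"
  have f: "(f k has_integral of_real (2 * pi * bin_weight n k)) {- pi..pi}" if "k \<ge> - int n" for k
    unfolding f_def by (rule has_integral_exp_bin_gen[OF that])
  have "((\<lambda>t. c0 * f 0 t + c1 * f 1 t + c1' * f (- 1) t + c2 * f 2 t + c2' * f (- 2) t) has_integral
     (c0 * of_real (2 * pi * bin_weight n 0) + c1 * of_real (2 * pi * bin_weight n 1) + c1' * of_real (2 * pi * bin_weight n (- 1))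
      + c2 * of_real (2 * pi * bin_weight n 2) + c2' * of_real (2 * pi * bin_weight n (- 2)))) {- pi..pi}"
    by (intro has_integral_add has_integral_mult_right f) (use assms in auto)
  also have "(\<lambda>t. c0 * f 0 t + c1 * f 1 t + c1' * f (- 1) t + c2 * f 2 t + c2' * f (- 2) t)
      = (\<lambda>t. trig_part (Complex e t) * bin_gen n (Complex e t))"
  proof
    fix t
    have "trig_part s = c0 + c1 * exp (- s) + c1' * exp s + c2 * exp (- (2 * s)) + c2' * exp (2 * s)" for s
      unfolding trig_part_def cosh_conv_exp sinh_conv_exp P_def[symmetric] c0_def c1_def c1'_def c2_def c2'_def
      by (simp add: field_simps)
    thus "c0 * f 0 t + c1 * f 1 t + c1' * f (- 1) t + c2 * f 2 t + c2' * f (- 2) t = trig_part (Complex e t) * bin_gen n (Complex e t)"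
      unfolding f_def by (simp add: distrib_right)
  qed
  also have "bin_weight n (- 1) = - bin_weight n 1" using assms by (simp add: bin_weight_minus)
  also have "bin_weight n (- 2) = - bin_weight n 2" using assms by (simp add: bin_weight_minus)
  also have "bin_weight n 0 = 0" by (simp add: bin_weight_def)
  also have "c0 * of_real (2 * pi * 0) + c1 * of_real (2 * pi * bin_weight n 1) + c1' * of_real (2 * pi * - bin_weight n 1)
      + c2 * of_real (2 * pi * bin_weight n 2) + c2' * of_real (2 * pi * - bin_weight n 2) = 
      of_real (2 * pi * (- 41 / 720 * bin_weight n 1 + 11 / 1440 * bin_weight n 2))"
    by (simp add: c1_def c1'_def c2_def c2'_def field_simps)
  finally show ?thesis .
qed

lemma lambert_integral:
  assumes "N \<ge> n"
  shows "((\<lambda>t. (\<Sum>p\<in>{..<N} \<times> {..<N}. lambert (Complex e t) p) * bin_gen n (Complex e t)) has_integral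
     of_real (2 * pi * real_of_int (F n))) {- pi..pi}"
proof -
  have "((\<lambda>t. \<Sum>p\<in>{..<N} \<times> {..<N}. of_nat (Suc (snd p)) * (exp (of_int (- int (Suc (fst p) * Suc (snd p))) * Complex e t) * bin_gen n (Complex e t)))
     has_integral (\<Sum>p\<in>{..<N} \<times> {..<N}. of_nat (Suc (snd p)) * of_real (2 * pi * bin_weight n (int (Suc (fst p) * Suc (snd p)))))) {- pi..pi}"
    by (intro has_integral_sum has_integral_mult_right has_integral_exp_bin_gen)
      (simp, linarith)
  moreover have "of_nat (Suc (snd p)) * (exp (of_int (- int (Suc (fst p) * Suc (snd p))) * s) * G) = lambert s p * G" for p s G
    unfolding lambert_def case_prod_unfold by (simp only: of_int_minus of_int_of_nat_eq mult_minus_left mult.assoc)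
  moreover have "(\<Sum>p\<in>{..<N} \<times> {..<N}. of_nat (Suc (snd p)) * complex_of_real (2 * pi * bin_weight n (int (Suc (fst p) * Suc (snd p)))))
     = of_real (2 * pi * real_of_int (F n))"
    unfolding sum_lambert_square[OF assms, symmetric] case_prod_unfold sum_distrib_left of_real_sum
    by (intro sum.cong refl) (simp only: of_real_mult of_real_of_nat_eq mult_ac)
  ultimately show ?thesis by (simp only: sum_distrib_right)
qed

lemma linear_term_integral:
  assumes "N \<ge> n"
  shows "((\<lambda>t. (\<Sum>k<N. linear_term k (Complex e t)) * bin_gen n (Complex e t)) has_integral 0) {- pi..pi}"
proof -
  have "((\<lambda>t. \<Sum>k<N. of_real (pi\<^sup>2 / 6 * real (Suc k) - 1 / 2) * (exp (of_int (- int (Suc k)) * Complex e t) * bin_gen n (Complex e t)))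
     has_integral (\<Sum>k<N. of_real (pi\<^sup>2 / 6 * real (Suc k) - 1 / 2) * of_real (2 * pi * bin_weight n (int (Suc k))))) {- pi..pi}"
    by (intro has_integral_sum has_integral_mult_right has_integral_exp_bin_gen) auto
  moreover have "of_real (pi\<^sup>2 / 6 * real (Suc k) - 1 / 2) * (exp (of_int (- int (Suc k)) * s) * G) = linear_term k s * G" for k s G
    unfolding linear_term_def by (simp only: of_int_minus of_int_of_nat_eq mult_minus_left mult.assoc)
  moreover have "(\<Sum>k<N. complex_of_real (pi\<^sup>2 / 6 * real (Suc k) - 1 / 2) * of_real (2 * pi * bin_weight n (int (Suc k)))) = 0"
  proof -
    have "(\<Sum>k<N. (pi\<^sup>2 / 6 * real (Suc k) - 1 / 2) * (2 * pi * bin_weight n (int (Suc k))))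
       = pi\<^sup>2 / 6 * (2 * pi) * (\<Sum>k<N. real (Suc k) * bin_weight n (int (Suc k))) - pi * (\<Sum>k<N. bin_weight n (int (Suc k)))"
      unfolding sum_distrib_left sum_subtractf[symmetric] by (intro sum.cong refl) (simp add: algebra_simps)
    also have "\<dots> = 0" unfolding sum_bin_weight_eq_0[OF assms] sum_k_bin_weight_eq_0[OF assms] by simp
    finally show ?thesis unfolding of_real_mult[symmetric] of_real_sum[symmetric] by simp
  qed
  ultimately show ?thesis by (simp only: sum_distrib_right)
qed

text \<open>The infinite series are never integrated. Finite sums close to them, uniformly on the
  line, have integrals that are known exactly, and the truncation errors times a bound
  \<open>B\<close> for \<open>bin_gen\<close> make up an arbitrary \<open>\<delta>\<close>.\<close>

lemma F_approx:
  assumes n: "n \<ge> 10000"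
  shows "\<bar>real_of_int (F n) - (- 41 / 720 * bin_weight n 1 + 11 / 1440 * bin_weight n 2)\<bar> \<le> 15700 * 4 ^ n"
proof -
  define e where "e = 2 / sqrt (real n)"
  have e0: "e > 0" using n by (simp add: e_def)
  define c where "c = - 41 / 720 * bin_weight n 1 + 11 / 1440 * bin_weight n 2"
  define B where "B = (\<Sum>j\<le>2 * n. norm (of_real (bin_weight n (int j - int n)) :: complex) * exp (of_int (int j - int n) * e))"
  have B: "norm (bin_gen n (Complex e t)) \<le> B" for t
    unfolding bin_gen_def B_def by (rule sum_norm_le) (simp add: norm_mult)
  have B0: "B \<ge> 0" unfolding B_def by (intro sum_nonneg) auto
  have main: "\<bar>real_of_int (F n) - c\<bar> \<le> 15700 * 4 ^ n + \<delta>" if \<delta>: "\<delta> > 0" for \<delta>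
  proof -
    \<comment> \<open>Two truncations, each off by at most \<open>d\<close>, cost
      \<open>2 * d * (B + 1) = \<delta>\<close>; the added 1 keeps the divisor positive.\<close>
    define d where "d = \<delta> / 2 / (B + 1)"
    have d: "d > 0" using \<delta> B0 by (simp add: d_def)
    obtain N1 where N1: "N1 \<ge> n" "\<And>s. Re s = e \<Longrightarrow>
       norm ((\<Sum>m. csch_half_sq (of_nat (Suc m) * s)) - (\<Sum>p\<in>{..<N1} \<times> {..<N1}. lambert s p)) \<le> d"
      using lambert_uniform_partial_sums[OF e0 d, of n] by blast
    obtain N2 where N2: "N2 \<ge> n" "\<And>s. Re s = e \<Longrightarrow> norm (linear_series s - (\<Sum>k<N2. linear_term k s)) \<le> d"
      using linear_term_uniform[OF e0 d, of n] by blast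
    define f where "f = (\<lambda>t. (\<Sum>p\<in>{..<N1} \<times> {..<N1}. lambert (Complex e t) p) * bin_gen n (Complex e t)
        - (\<Sum>k<N2. linear_term k (Complex e t)) * bin_gen n (Complex e t) - trig_part (Complex e t) * bin_gen n (Complex e t))"
    have "(f has_integral (of_real (2 * pi * real_of_int (F n)) - 0 - of_real (2 * pi * c))) (cbox (- pi) pi)"
      unfolding f_def c_def cbox_interval
      by (intro has_integral_diff lambert_integral linear_term_integral trig_part_integral N1 N2) (use n in auto)
    moreover have "norm (f t) \<le> 15700 * 4 ^ n + \<delta>" if t: "t \<in> cbox (- pi) pi" for t
    proof -
      define s where "s = Complex e t"
      have s: "Re s = e" by (simp add: s_def)
      define x where "x = (\<Sum>m. csch_half_sq (of_nat (Suc m) * s)) - (\<Sum>p\<in>{..<N1} \<times> {..<N1}. lambert s p)"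
      define y where "y = linear_series s - (\<Sum>k<N2. linear_term k s)"
      have "f t = ((\<Sum>m. csch_half_sq (of_nat (Suc m) * s)) - linear_series s - trig_part s) * bin_gen n s - (x - y) * bin_gen n s"
        by (simp add: f_def s_def[symmetric] x_def y_def algebra_simps)
      also have "norm \<dots> \<le> norm (((\<Sum>m. csch_half_sq (of_nat (Suc m) * s)) - linear_series s - trig_part s) * bin_gen n s) + norm ((x - y) * bin_gen n s)"
        by (rule norm_triangle_ineq4)
      also have "norm (((\<Sum>m. csch_half_sq (of_nat (Suc m) * s)) - linear_series s - trig_part s) * bin_gen n s) \<le> 15700 * 4 ^ n"
        unfolding s_def by (rule integrand_bound[OF n]) (use t in \<open>auto simp: e_def\<close>)
      also have "norm ((x - y) * bin_gen n s) \<le> (2 * d) * (B + 1)"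
      proof -
        have "norm (x - y) \<le> 2 * d"
          using norm_triangle_ineq4[of x y] N1(2)[OF s] N2(2)[OF s] unfolding x_def[symmetric] y_def[symmetric] by linarith
        moreover have "norm (bin_gen n s) \<le> B + 1" using B[of t] by (simp add: s_def)
        ultimately show ?thesis unfolding norm_mult using d by (intro mult_mono) auto
      qed
      also have "(2 * d) * (B + 1) = \<delta>"
      proof -
        have "B + 1 \<noteq> 0" using B0 by linarith
        hence "d * (B + 1) = \<delta> / 2" by (rule nonzero_eq_divide_eq[THEN iffD1]) (rule d_def)
        thus ?thesis by (simp only: mult.assoc)
      qed
      finally show ?thesis by simp
    qed
    ultimately have "norm (complex_of_real (2 * pi * real_of_int (F n)) - 0 - of_real (2 * pi * c)) \<le> (15700 * 4 ^ n + \<delta>) * measure lborel (cbox (- pi) pi)"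
      using \<delta> by (intro has_integral_bound) auto
    also have "complex_of_real (2 * pi * real_of_int (F n)) - 0 - of_real (2 * pi * c) = of_real (2 * pi * (real_of_int (F n) - c))"
      by (simp add: algebra_simps)
    also have "norm (complex_of_real (2 * pi * (real_of_int (F n) - c))) = 2 * pi * \<bar>real_of_int (F n) - c\<bar>"
      unfolding norm_of_real by (simp add: abs_mult)
    also have "measure lborel (cbox (- pi) pi) = 2 * pi" by simp
    finally have "2 * pi * \<bar>real_of_int (F n) - c\<bar> \<le> 2 * pi * (15700 * 4 ^ n + \<delta>)" by (simp only: mult.commute)
    thus ?thesis by (rule mult_left_le_imp_le) simp
  qed
  show ?thesis using field_le_epsilon[OF main] unfolding c_def .
qed

section \<open>Evaluation of the main term\<close>

text \<open>The recurrence along the row makes both weights rational multiples of the central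
  binomial coefficient. Polynomial division then leaves, besides the main term, a bounded rational
  function with limit 2.\<close>

lemma bin_weight_main_term:
  assumes "n \<ge> 2"
  shows "- 41 / 720 * bin_weight n 1 + 11 / 1440 * bin_weight n 2 =
    real ((2 * n) choose n) * (- (real n)\<^sup>2 / 8 + real n / 24 + real n * (4 * real n - 3) / (2 * (real n + 1) * (real n + 2)))"
proof -
  define b where "b = real ((2 * n) choose n)"
  define x where "x = real n"
  have x: "x + 1 \<noteq> 0" "x + 2 \<noteq> 0" by (simp_all add: x_def add_nonneg_eq_0_iff)
  have b1: "real ((2 * n) choose (n + 1)) = x / (x + 1) * b"
    using binomial_central_Suc[of n 0] x by (simp add: b_def x_def field_simps)
  have b2: "real ((2 * n) choose (n + 2)) = (x - 1) / (x + 2) * (x / (x + 1) * b)"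
    using binomial_central_Suc[of n 1] x unfolding b1[symmetric] by (simp add: x_def field_simps)
  have g1: "bin_weight n 1 = 3 * (x - 1) * (x - 2) * (x / (x + 1) * b)"
  proof -
    have "nat (int n + 1) = n + 1" by simp
    thus ?thesis unfolding b1[symmetric] bin_weight_def by (simp add: x_def algebra_simps)
  qed
  have g2: "bin_weight n 2 = 6 * (x - 2) * (x - 8) * ((x - 1) / (x + 2) * (x / (x + 1) * b))"
  proof -
    have "nat (int n + 2) = n + 2" by simp
    thus ?thesis unfolding b2[symmetric] bin_weight_def by (simp add: x_def algebra_simps)
  qed
  have "- 41 / 720 * (3 * (x - 1) * (x - 2) * (x / (x + 1))) + 11 / 1440 * (6 * (x - 2) * (x - 8) * ((x - 1) / (x + 2) * (x / (x + 1))))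
     = - x\<^sup>2 / 8 + x / 24 + x * (4 * x - 3) / (2 * (x + 1) * (x + 2))"
    using x by (simp add: divide_simps) (simp add: algebra_simps power2_eq_square)
  moreover have "- 41 / 720 * (3 * (x - 1) * (x - 2) * (u * b)) + 11 / 1440 * (6 * (x - 2) * (x - 8) * (v * (u * b)))
     = b * (- 41 / 720 * (3 * (x - 1) * (x - 2) * u) + 11 / 1440 * (6 * (x - 2) * (x - 8) * (v * u)))" for u v
    by (simp add: algebra_simps)
  ultimately show ?thesis unfolding g1 g2 x_def[symmetric] b_def[symmetric] by (simp only:)
qed

theorem mainTheorem1:
  fixes n :: nat
  assumes "n \<ge> 10000"
  shows "\<bar>real_of_int (F n) / real ((2 * n) choose n) - (- ((real n)\<^sup>2 / 8) + real n / 24)\<bar>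
           \<le> 38755553 / 5000 * real n powr (3 / 4)"
proof -
  define b where "b = real ((2 * n) choose n)"
  define r where "r = real n * (4 * real n - 3) / (2 * (real n + 1) * (real n + 2))"
  define M where "M = - (real n)\<^sup>2 / 8 + real n / 24"
  \<comment> \<open>In terms of the fourth root, both sqrt n and n^(3/4) become integral
    powers.\<close>
  define q where "q = real n powr (1 / 4)"
  have b: "b > 0" by (simp add: b_def)
  have q: "q \<ge> 10"
  proof -
    have "10 = (10 ^ 4 :: real) powr (1 / 4)" by (simp add: powr_realpow[symmetric] powr_powr)
    also have "\<dots> \<le> real n powr (1 / 4)" using assms by (intro powr_mono2) auto
    finally show ?thesis by (simp add: q_def)
  qed
  have qs: "sqrt (real n) = q\<^sup>2" "real n powr (3 / 4) = q ^ 3"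
    using assms by (simp_all add: q_def powr_half_sqrt[symmetric] powr_powr flip: powr_realpow)
  have r: "0 \<le> r" "r \<le> 2"
  proof -
    show "0 \<le> r" unfolding r_def using assms by (intro divide_nonneg_nonneg mult_nonneg_nonneg) auto
    have "real n * (4 * real n - 3) \<le> 2 * (2 * (real n + 1) * (real n + 2))" by (simp add: algebra_simps)
    thus "r \<le> 2" unfolding r_def by (simp add: divide_le_eq)
  qed
  have "\<bar>real_of_int (F n) - b * (M + r)\<bar> \<le> 15700 * 4 ^ n"
    using F_approx[OF assms] bin_weight_main_term[of n] assms unfolding b_def M_def r_def by simp
  also have "\<dots> \<le> 15700 * (2 * sqrt (real n) * b)"
    unfolding b_def using assms by (intro mult_left_mono central_binomial_ge) auto
  finally have "\<bar>real_of_int (F n) - b * (M + r)\<bar> / b \<le> 31400 * sqrt (real n)"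
    using b by (simp add: divide_le_eq mult_ac)
  moreover have "\<bar>real_of_int (F n) - b * (M + r)\<bar> / b = \<bar>real_of_int (F n) / b - (M + r)\<bar>"
  proof -
    have h: "real_of_int (F n) / b - (M + r) = (real_of_int (F n) - b * (M + r)) / b" using b by (simp add: field_simps)
    show ?thesis unfolding h abs_divide using b by simp
  qed
  ultimately have "\<bar>real_of_int (F n) / b - (M + r)\<bar> \<le> 31400 * q\<^sup>2" by (simp only: qs(1))
  hence "\<bar>real_of_int (F n) / b - M\<bar> \<le> 31400 * q\<^sup>2 + 2" using r by linarith
  \<comment> \<open>The error obtained so far is O(sqrt n). The bound \<open>q \<ge> 10\<close>,
    which is \<open>n \<ge> 10000\<close>, trades q^2 for a tenth of q^3, and the last unit of 3141
    absorbs the 2.\<close>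
  also have "\<dots> \<le> 3141 * q ^ 3"
  proof -
    have "q\<^sup>2 * 10 \<le> q\<^sup>2 * q" using q by (intro mult_left_mono) auto
    moreover have "10\<^sup>2 \<le> q\<^sup>2" using q by (intro power_mono) auto
    moreover have "q ^ 3 = q\<^sup>2 * q" by (simp add: power2_eq_square power3_eq_cube)
    ultimately show ?thesis by simp
  qed
  also have "\<dots> \<le> 38755553 / 5000 * q ^ 3" using q by (intro mult_right_mono) auto
  finally show ?thesis unfolding qs(2) b_def M_def by simp
qed


end
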